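(* Set $\mu(\mathrm{d}x):=\frac{W(x)}{x}\,\mathrm{d}x$ for $x>0$. Then $\mu$ is the unique (up to a constant multiple) stationary measure on $(0,+\infty)$ for the CB process $(Z_t)_{t\ge 0}$ with branching mechanism $\psi$; here $W$ is the scale function associated with $\psi$.
   Context: Branching mechanism: $\psi(\lambda)=\alpha\lambda+\frac12\sigma^2\lambda^2+\int_0^{+\infty}(e^{-\lambda r}-1+\lambda r)\,\pi(\mathrm{d}r)$, $\lambda\ge 0$, where $\alpha\ge 0$, $\sigma\ge 0$ and $\pi$ is a positive Radon measure on $(0,+\infty)$ with $\int_0^{+\infty}(r\wedge r^2)\,\pi(\mathrm{d}r)<+\infty$. It is assumed that $\psi(+\infty)=+\infty$ and $\int^{+\infty}\frac{1}{\psi(\lambda)}\,\mathrm{d}\lambda<+\infty$ (integrability at $+\infty$). CB process: $((Z_t)_{t\ge 0},(\mathbb{P}_x)_{x\ge 0})$ is the $[0,+\infty)$-valued right continuous strong Markov process with left limits, absorbed at $0$, with $\mathbb{P}_x(Z_0=x)=1$, and such that the $\mathbb{P}_x$-expectation of $e^{-\lambda Z_t}$ equals $e^{-x u_t(\lambda)}$ for $\lambda>0$, $t\ge 0$, where $\frac{\partial}{\partial t}u_t(\lambda)=-\psi(u_t(\lambda))$, $u_0(\lambda)=\lambda$. Scale function: $W$ is the unique strictly increasing, nonnegative, continuous function on $[0,+\infty)$ with $\int_0^{+\infty}e^{-\lambda x}W(x)\,\mathrm{d}x=\frac1{\psi(\lambda)}$ for all $\lambda>0$. Stationary measure: a Radon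 measure $\nu$ on $(0,+\infty)$ such that $\int_{(0,+\infty)}\mathbb{P}_x(Z_t\in A)\,\nu(\mathrm{d}x)=\nu(A)$ for every $t>0$ and every Borel set $A\subset(0,+\infty)$. *)

theory Defs
  imports "HOL-Probability.Probability"
begin

text \<open>
  Measures on \<open>(0, \<infinity>)\<close> are values of type \<open>real measure\<close> whose underlying space is the
  subspace \<open>{0<..}\<close> of \<open>borel\<close>. As \<open>(0, \<infinity>)\<close> is locally compact and second countable, a Borel
  measure on it that is finite on compact sets is automatically regular, so finiteness on
  compact subsets of the open half-line is the whole Radon condition; mass may accumulate at 0.
\<close>

definition radon_on_pos :: "real measure \<Rightarrow> bool" where
  "radon_on_pos \<nu> \<longleftrightarrow>
     sets \<nu> = sets (restrict_space borel {0<..}) \<and>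
     (\<forall>K. compact K \<and> K \<subseteq> {0<..} \<longrightarrow> emeasure \<nu> K < \<infinity>)"

text \<open>Meaningful for \<open>q \<ge> 0\<close> only.\<close>

definition branching_psi :: "real \<Rightarrow> real \<Rightarrow> real measure \<Rightarrow> real \<Rightarrow> real" where
  "branching_psi \<alpha> \<sigma> \<pi> q =
     \<alpha> * q + 1 / 2 * \<sigma>\<^sup>2 * q\<^sup>2 + (LINT r|\<pi>. exp (- q * r) - 1 + q * r)"

locale branching_mechanism =
  fixes \<alpha> \<sigma> :: real and \<pi> :: "real measure"
  assumes alpha_nonneg: "0 \<le> \<alpha>"
    and sigma_nonneg: "0 \<le> \<sigma>"
    and radon_pi: "radon_on_pos \<pi>"
    and pi_moment: "(\<integral>\<^sup>+ r. ennreal (min r (r\<^sup>2)) \<partial>\<pi>) < \<infinity>"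
    and psi_at_top: "filterlim (branching_psi \<alpha> \<sigma> \<pi>) at_top at_top"
    and psi_inverse_integrable:
      "\<exists>a>0. set_integrable lborel {a..} (\<lambda>q. 1 / branching_psi \<alpha> \<sigma> \<pi> q)"

text \<open>
  \<open>u t q\<close> is \<open>u\<^sub>t(q)\<close>. Since \<open>\<psi>\<close> is defined on \<open>[0, \<infinity>)\<close> only, a solution
  of the differential equation takes its values there. The derivative at time 0 is one-sided.
\<close>

definition cumulant_flow :: "(real \<Rightarrow> real) \<Rightarrow> (real \<Rightarrow> real \<Rightarrow> real) \<Rightarrow> bool" where
  "cumulant_flow \<psi> u \<longleftrightarrow>
     (\<forall>q>0. u 0 q = q \<and>
       (\<forall>t\<ge>0. 0 \<le> u t q \<and>
         ((\<lambda>s. u s q) has_real_derivative - \<psi> (u t q)) (at t within {0..})))"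

text \<open>
  \<open>Z t\<close> lives on the measurable space \<open>M\<close> (only \<open>space M\<close> and \<open>sets M\<close> matter) and
  \<open>P x\<close> is the law started at \<open>x\<close>; only times \<open>t \<ge> 0\<close> and starting points \<open>x \<ge> 0\<close> matter.
  The filtration \<open>F\<close> is any one to which \<open>Z\<close> is adapted, e.g. the natural one.
  It is indexed by \<open>[0, \<infinity>]\<close> so that stopping times may be infinite; the strong Markov
  property is then the usual identity on the event that \<open>T\<close> is finite.
\<close>

locale cb_process = filtration "space M" F
  for M :: "'w measure" and F :: "ennreal \<Rightarrow> 'w measure" +
  fixes P :: "real \<Rightarrow> 'w measure"
    and Z :: "real \<Rightarrow> 'w \<Rightarrow> real"
    and \<psi> :: "real \<Rightarrow> real"
    and u :: "real \<Rightarrow> real \<Rightarrow> real"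
  assumes sets_F_subset: "\<And>t. sets (F t) \<subseteq> sets M"
    and prob_space_P: "\<And>x. 0 \<le> x \<Longrightarrow> prob_space (P x)"
    and sets_P: "\<And>x. 0 \<le> x \<Longrightarrow> sets (P x) = sets M"
    and adapted: "\<And>t. 0 \<le> t \<Longrightarrow> Z t \<in> borel_measurable (F (ennreal t))"
    and Z_nonneg: "\<And>t \<omega>. 0 \<le> t \<Longrightarrow> \<omega> \<in> space M \<Longrightarrow> 0 \<le> Z t \<omega>"
    and right_continuous:
      "\<And>t \<omega>. 0 \<le> t \<Longrightarrow> \<omega> \<in> space M \<Longrightarrow> continuous (at_right t) (\<lambda>s. Z s \<omega>)"
    and left_limits:
      "\<And>t \<omega>. 0 < t \<Longrightarrow> \<omega> \<in> space M \<Longrightarrow> \<exists>l. ((\<lambda>s. Z s \<omega>) \<longlongrightarrow> l) (at_left t)"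
    and start: "\<And>x. 0 \<le> x \<Longrightarrow> AE \<omega> in P x. Z 0 \<omega> = x"
    and absorbed_at_0:
      "\<And>x. 0 \<le> x \<Longrightarrow> AE \<omega> in P x. \<forall>s\<ge>0. Z s \<omega> = 0 \<longrightarrow> (\<forall>t\<ge>s. Z t \<omega> = 0)"
    and transition_kernel:
      "\<And>t. 0 \<le> t \<Longrightarrow>
        (\<lambda>x. distr (P x) borel (Z t)) \<in> restrict_space borel {0..} \<rightarrow>\<^sub>M prob_algebra borel"
    and strong_markov:
      "\<And>x T A t B. 0 \<le> x \<Longrightarrow> stopping_time F T \<Longrightarrow> A \<in> sets (pre_sigma T) \<Longrightarrow>
        0 \<le> t \<Longrightarrow> B \<in> sets borel \<Longrightarrow>
        emeasure (P x) {\<omega> \<in> A. T \<omega> < \<infinity> \<and> Z (enn2real (T \<omega>) + t) \<omega> \<in> B} =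
        (\<integral>\<^sup>+ \<omega> \<in> {\<omega> \<in> A. T \<omega> < \<infinity>}.
           emeasure (P (Z (enn2real (T \<omega>)) \<omega>)) {\<omega>' \<in> space M. Z t \<omega>' \<in> B} \<partial>P x)"
    and flow: "cumulant_flow \<psi> u"
    and laplace:
      "\<And>x t q. 0 \<le> x \<Longrightarrow> 0 \<le> t \<Longrightarrow> 0 < q \<Longrightarrow>
        (LINT \<omega>|P x. exp (- q * Z t \<omega>)) = exp (- x * u t q)"

text \<open>The values of \<open>W\<close> on the negative half-line are irrelevant.\<close>

definition scale_function :: "(real \<Rightarrow> real) \<Rightarrow> (real \<Rightarrow> real) \<Rightarrow> bool" where
  "scale_function \<psi> W \<longleftrightarrow>
     strict_mono_on {0..} W \<and> (\<forall>x\<ge>0. 0 \<le> W x) \<and> continuous_on {0..} W \<and>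
     (\<forall>q>0. set_integrable lborel {0..} (\<lambda>x. exp (- q * x) * W x) \<and>
            (LINT x:{0..}|lborel. exp (- q * x) * W x) = 1 / \<psi> q)"

definition stationary_measure ::
    "(real \<Rightarrow> 'w measure) \<Rightarrow> (real \<Rightarrow> 'w \<Rightarrow> real) \<Rightarrow> real measure \<Rightarrow> bool" where
  "stationary_measure P Z \<nu> \<longleftrightarrow>
     radon_on_pos \<nu> \<and>
     (\<forall>t>0. \<forall>A\<in>sets borel. A \<subseteq> {0<..} \<longrightarrow>
        (\<integral>\<^sup>+ x. emeasure (P x) {\<omega> \<in> space (P x). Z t \<omega> \<in> A} \<partial>\<nu>) = emeasure \<nu> A)"

end

theory Submission
  imports Defs
begin

text \<open>
  Write \<open>\<Phi>(q) = \<integral>\<^sub>q\<^sup>\<infinity> dr / \<psi>(r)\<close>, which is finite by Grey's condition. Two computations drive the proof.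
  Since \<open>1 / \<psi>\<close> is the Laplace transform of \<open>W\<close>, integrating it from \<open>q\<close> to \<open>\<infinity>\<close> and exchanging the
  integrals shows that \<open>\<Phi>\<close> is the Laplace transform of \<open>\<mu>(dx) = W(x) / x dx\<close>
  (\<open>Phi_eq_laplace\<close>). Since \<open>du\<^sub>t/dt = - \<psi>(u\<^sub>t)\<close>, the function \<open>\<Phi>\<close> turns the cumulant flow into
  translation: \<open>\<Phi>(u\<^sub>t(q)) = \<Phi>(q) + t\<close> (\<open>Phi_u\<close>).

  The test functions are the gaps \<open>e(x) = exp (- p x) - exp (- q x)\<close> with \<open>0 < p \<le> q\<close>. They are
  nonnegative and vanish at 0, so the mass absorbed at 0 contributes nothing, and the
  transition semigroup sends the gap of \<open>(p, q)\<close> to the gap of \<open>(u\<^sub>t(p), u\<^sub>t(q))\<close>. The gaps of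
  \<open>(k, k + 1)\<close>, for integers \<open>k \<ge> 1\<close>, already determine a measure on the open half-line for which
  they are integrable (\<open>measure_on_pos_eq_of_exp_gap_eq\<close>), by reduction to the moment problem on
  the unit interval.

  \<^emph>\<open>Stationarity of \<mu>.\<close> The \<open>\<mu>\<close>-integral of a gap is \<open>\<Phi>(p) - \<Phi>(q)\<close>, and this difference does not
  change when \<open>p\<close> and \<open>q\<close> move along the flow, as both values increase by \<open>t\<close>.

  \<^emph>\<open>Uniqueness.\<close> A stationary Radon measure \<open>\<nu>\<close> integrates all gaps
  (\<open>stationary_exp_gap_finite\<close>): for suitable \<open>t\<close> and a compact interval \<open>K\<close> in \<open>(0, \<infinity>)\<close> the
  gap is at most a constant times \<open>P\<^sub>x(Z\<^sub>t \<in> K)\<close>, whose \<open>\<nu>\<close>-integral is \<open>\<nu>(K) < \<infinity>\<close>. Let \<open>G(p, q)\<close> be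
  the \<open>\<nu>\<close>-integral of the gap. It is nonnegative, additive over adjacent intervals and invariant under
  the flow; in the time coordinate \<open>\<Phi>\<close> it is an additive translation invariant
  function of intervals. Cauchy's functional equation then gives
  \<open>G(p, q) = c (\<Phi>(p) - \<Phi>(q))\<close> (\<open>stationary_exp_gap\<close>), which are the gaps of \<open>c \<mu>\<close>.
\<close>

section \<open>Measures on the half-line and their Laplace transforms\<close>

text \<open>
Moments fix the integrals of polynomials, and by the Weierstrass theorem polynomials are
uniformly dense in the continuous functions on the unit interval.
\<close>
lemma continuous_integral_eq_of_moments_eq:
  fixes M N :: "real measure"
  assumes M: "real_distribution M" and N: "real_distribution N"
    and M01: "AE x in M. x \<in> {0..1}" and N01: "AE x in N. x \<in> {0..1}"
    and moments: "\<And>n::nat. (LINT x|M. x ^ n) = (LINT x|N. x ^ n)"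
    and g: "continuous_on UNIV g"
  shows "(LINT x|M. g x) = (LINT x|N. g x :: real)"
proof -
  have near: "\<bar>(LINT x|K. g x) - (LINT x|K. p x)\<bar> \<le> e"
    if K: "real_distribution K" and K01: "AE x in K. x \<in> {0..1}"
      and p: "continuous_on UNIV p" and e: "\<And>x. x \<in> {0..1} \<Longrightarrow> \<bar>g x - p x\<bar> < e"
    for K e and p :: "real \<Rightarrow> real"
  proof -
    interpret real_distribution K by fact
    have integrable_K: "integrable K h" if h: "continuous_on UNIV h" for h :: "real \<Rightarrow> real"
    proof -
      have "compact (h ` {0..1})"
        using h by (intro compact_continuous_image) (auto intro: continuous_on_subset)
      then obtain B where "\<And>x. x \<in> {0..1} \<Longrightarrow> \<bar>h x\<bar> \<le> B"
        using compact_imp_bounded bounded_iff by (metis image_eqI real_norm_def)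
      then show ?thesis
        using K01 borel_measurable_continuous_onI[OF h]
        by (intro integrable_const_bound[where B = B]) auto
    qed
    have "\<bar>(LINT x|K. g x) - (LINT x|K. p x)\<bar> = \<bar>LINT x|K. g x - p x\<bar>"
      using integrable_K[OF g] integrable_K[OF p] by simp
    also have "\<dots> \<le> (LINT x|K. \<bar>g x - p x\<bar>)"
      by (rule integral_abs_bound)
    also have "\<dots> \<le> (LINT x|K. e)"
      using integrable_K[OF g] integrable_K[OF p] K01 e
      by (intro integral_mono_AE) (auto intro: less_imp_le)
    finally show ?thesis using prob_space by simp
  qed
  have "\<bar>(LINT x|M. g x) - (LINT x|N. g x)\<bar> \<le> 0 + e" if "0 < e" for e
  proof -
    obtain p where p: "real_polynomial_function p" "\<And>x. x \<in> {0..1} \<Longrightarrow> \<bar>g x - p x\<bar> < e / 2"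
      using Stone_Weierstrass_real_polynomial_function[of "{0..1::real}" g "e / 2"]
        \<open>0 < e\<close> continuous_on_subset[OF g] by auto
    then obtain a n where a: "p = (\<lambda>x. \<Sum>i\<le>n. a i * x ^ i)"
      using real_polynomial_function_iff_sum by blast
    have cont_p: "continuous_on UNIV p"
      unfolding a by (intro continuous_intros)
    have int: "integrable K (\<lambda>x. x ^ i)" if "real_distribution K" "AE x in K. x \<in> {0..1}" for K and i :: nat
    proof -
      interpret real_distribution K by fact
      show ?thesis
        using that(2) by (intro integrable_const_bound[where B = 1]) (auto simp: power_le_one)
    qed
    have "(LINT x|M. p x) = (LINT x|N. p x)"
      unfolding a using int[OF M M01] int[OF N N01] moments by simp
    then show ?thesis
      using near[OF M M01 cont_p p(2)] near[OF N N01 cont_p p(2)] by (simp add: abs_le_iff) argo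
  qed
  then show ?thesis
    using field_le_epsilon[of "\<bar>(LINT x|M. g x) - (LINT x|N. g x)\<bar>" 0] by simp
qed

lemma real_distribution_eq_of_moments_eq:
  fixes M N :: "real measure"
  assumes M: "real_distribution M" and N: "real_distribution N"
    and "AE x in M. x \<in> {0..1}" "AE x in N. x \<in> {0..1}"
    and "\<And>n::nat. (LINT x|M. x ^ n) = (LINT x|N. x ^ n)"
  shows "M = N"
proof (rule Levy_uniqueness[OF M N])
  have eq: "(LINT x|M. g x) = (LINT x|N. g x)" if "continuous_on UNIV g" for g :: "real \<Rightarrow> real"
    by (rule continuous_integral_eq_of_moments_eq[OF assms that])
  have char_eq: "char K t = Complex (LINT x|K. cos (t * x)) (LINT x|K. sin (t * x))"
    if "real_distribution K" for K t
  proof -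
    interpret real_distribution K by fact
    have "integrable K (\<lambda>x. iexp (t * x))"
      by (intro integrable_const_bound[where B = 1]) auto
    then show ?thesis
      by (simp add: char_def complex_eq_iff  flip: Re_exp Im_exp integral_Re integral_Im)
         (simp add: Re_exp Im_exp)
  qed
  show "char M = char N"
    using eq by (auto simp: char_eq[OF M] char_eq[OF N] intro!: ext eq continuous_intros)
qed

text \<open>
Under the substitution \<open>y = exp (- x)\<close> the half-line becomes a subset of the unit interval, and
the Laplace transform at \<open>n\<close> becomes the \<open>n\<close>-th moment. Values at the natural numbers therefore
suffice.
\<close>
lemma finite_measure_eq_of_laplace_eq:
  fixes M N :: "real measure"
  assumes sets: "sets M = sets borel" "sets N = sets borel"
    and nonneg: "AE x in M. 0 \<le> x" "AE x in N. 0 \<le> x"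
    and fin: "emeasure M UNIV < \<infinity>"
    and laplace: "\<And>n::nat. (\<integral>\<^sup>+x. ennreal (exp (- real n * x)) \<partial>M) = (\<integral>\<^sup>+x. ennreal (exp (- real n * x)) \<partial>N)"
  shows "M = N"
proof -
  have space: "space M = UNIV" "space N = UNIV"
    using sets[THEN sets_eq_imp_space_eq] by auto
  have [measurable_cong]: "sets M = sets borel" "sets N = sets borel" by fact+
  \<comment> \<open>The two masses agree (take \<open>n = 0\<close>), so both measures can be normalised by the same constant.\<close>
  define m where "m = emeasure M UNIV"
  have mN: "emeasure N UNIV = m"
    using laplace[of 0] by (simp add: m_def space)
  show ?thesis
  proof (cases "m = 0")
    case True
    show ?thesis
    proof (rule measure_eqI)
      fix A assume "A \<in> sets M"
      then have "emeasure M A \<le> m" "emeasure N A \<le> m"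
        using emeasure_space[of M A] emeasure_space[of N A] space by (simp_all add: m_def mN)
      then show "emeasure M A = emeasure N A" by (simp add: True)
    qed (simp add: sets)
  next
    case False
    define D where "D K = distr (scale_measure (inverse m) K) borel (\<lambda>x. exp (- x))" for K :: "real measure"
    have m1: "inverse m * m = 1"
      using False fin by (simp add: m_def ennreal_inverse_mult[of m] mult.commute ennreal_mult_divide_eq ennreal_divide_self divide_ennreal_def[symmetric])
    have D: "real_distribution (D K)" "AE x in D K. x \<in> {0..1}"
        "(LINT x|D K. x ^ n) = enn2real (inverse m * (\<integral>\<^sup>+x. ennreal (exp (- real n * x)) \<partial>K))"
        "K = scale_measure m (distr (D K) borel (\<lambda>y. - ln y))"
      if [measurable_cong]: "sets K = sets borel" and K0: "AE x in K. 0 \<le> x" and K: "emeasure K UNIV = m"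
      for K and n :: nat
    proof -
      have spK: "space K = UNIV" using that(1) sets_eq_imp_space_eq by fastforce
      have "prob_space (scale_measure (inverse m) K)"
        by (rule prob_spaceI) (simp add: space_scale_measure spK K m1)
      then interpret SK: prob_space "scale_measure (inverse m) K" .
      show "real_distribution (D K)"
        unfolding D_def by (rule SK.real_distribution_distr) simp
      have AE': "AE x in scale_measure (inverse m) K. 0 \<le> x"
        using K0 by (auto simp: eventually_ae_filter null_sets_def space_scale_measure)
      then show "AE x in D K. x \<in> {0..1}"
        unfolding D_def by (subst AE_distr_iff) auto
      show "(LINT x|D K. x ^ n) = enn2real (inverse m * (\<integral>\<^sup>+x. ennreal (exp (- real n * x)) \<partial>K))"
        unfolding D_def
        by (subst integral_distr)
           (auto simp: integral_eq_nn_integral nn_integral_scale_measure exp_of_nat_mult[symmetric])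
      have "distr (D K) borel (\<lambda>y. - ln y) = distr (scale_measure (inverse m) K) borel (\<lambda>x. x)"
        unfolding D_def by (subst distr_distr) (auto simp: comp_def)
      also have "\<dots> = scale_measure (inverse m) K"
        by (rule distr_id2) (simp add: that)
      finally show "K = scale_measure m (distr (D K) borel (\<lambda>y. - ln y))"
        using m1 by (simp add: mult.commute)
    qed
    have "D M = D N"
      using sets nonneg mN laplace
      by (intro real_distribution_eq_of_moments_eq D(1,2)) (simp_all add: D(3) m_def)
    then show ?thesis
      using D(4)[OF sets(1) nonneg(1)] D(4)[OF sets(2) nonneg(2) mN] by (simp add: m_def)
  qed
qed

text \<open>
A difference of two decaying exponentials vanishes at 0 and at infinity, so it can be integrable for
a measure on \<open>(0, \<infinity>)\<close> that has infinite mass near 0.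
\<close>
definition exp_gap :: "real \<Rightarrow> real \<Rightarrow> real \<Rightarrow> real" where
  "exp_gap p q x = exp (- p * x) - exp (- q * x)"

lemma exp_gap_measurable [measurable]: "exp_gap p q \<in> borel_measurable borel"
  unfolding exp_gap_def by measurable

lemma exp_gap_nonneg: "p \<le> q \<Longrightarrow> 0 \<le> x \<Longrightarrow> 0 \<le> exp_gap p q x"
  by (simp add: exp_gap_def mult_right_mono)

lemma exp_gap_factor: "exp_gap p q x = exp (- p * x) * (1 - exp (- (q - p) * x))"
  by (simp add: exp_gap_def algebra_simps flip: exp_add)

lemma exp_gap_le_exp: "exp_gap p q x \<le> exp (- p * x)"
  by (simp add: exp_gap_def)

lemma exp_gap_le_linear:
  assumes "0 \<le> p" "p \<le> q" "0 \<le> x" shows "exp_gap p q x \<le> (q - p) * x"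
proof -
  have "1 - exp (- (q - p) * x) \<le> (q - p) * x"
    using exp_ge_add_one_self[of "- (q - p) * x"] by (simp add: algebra_simps)
  moreover have "0 \<le> 1 - exp (- (q - p) * x)" using mult_nonpos_nonneg[of "p - q" x] assms(2,3) by simp
  moreover have "exp (- p * x) \<le> 1" using assms by simp
  ultimately have "exp (- p * x) * (1 - exp (- (q - p) * x)) \<le> 1 * ((q - p) * x)"
    by (intro mult_mono) auto
  then show ?thesis by (simp add: exp_gap_factor)
qed

lemma exp_gap_ge_linear:
  assumes "0 \<le> p" "p \<le> q" "0 \<le> x" "x \<le> 1" shows "(q - p) * exp (- q) * x \<le> exp_gap p q x"
proof -
  have "(q - p) * x \<le> exp ((q - p) * x) - 1"
    using exp_ge_add_one_self[of "(q - p) * x"] by linarith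
  moreover have "exp (- q) \<le> exp (- q * x)" using assms by (simp add: mult_left_le)
  ultimately have "exp (- q) * ((q - p) * x) \<le> exp (- q * x) * (exp ((q - p) * x) - 1)"
    using assms by (intro mult_mono) auto
  also have "\<dots> = exp_gap p q x"
    by (simp add: exp_gap_def algebra_simps flip: exp_add)
  finally show ?thesis by (simp add: algebra_simps)
qed

lemma space_on_pos: "sets \<nu> = sets (restrict_space borel {0::real<..}) \<Longrightarrow> space \<nu> = {0<..}"
  using sets_eq_imp_space_eq[of \<nu> "restrict_space borel {0<..}"] by (simp add: space_restrict_space)
lemma borel_measurable_on_pos:
  assumes "sets M = sets (restrict_space borel {0::real<..})" "f \<in> borel_measurable borel"
  shows "f \<in> borel_measurable M"
  using measurable_restrict_space1[OF assms(2)] measurable_cong_sets[OF assms(1) refl] by blast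

text \<open>
The positive weight \<open>w(x) = exp (- x) - exp (- 2 x)\<close> makes the measures finite, and
\<open>w(x) exp (- n x)\<close> is the gap of \<open>(n + 1, n + 2)\<close>. Hence the Laplace transforms of the weighted measures
agree at all natural numbers; dividing by \<open>w\<close> recovers the original measures.
\<close>
lemma measure_on_pos_eq_of_exp_gap_eq:
  fixes M N :: "real measure"
  assumes sets: "sets M = sets (restrict_space borel {0<..})" "sets N = sets (restrict_space borel {0<..})"
    and eq: "\<And>k. 1 \<le> k \<Longrightarrow> (\<integral>\<^sup>+x. ennreal (exp_gap (real k) (real (Suc k)) x) \<partial>M) =
      (\<integral>\<^sup>+x. ennreal (exp_gap (real k) (real (Suc k)) x) \<partial>N)"
    and fin: "(\<integral>\<^sup>+x. ennreal (exp_gap 1 2 x) \<partial>M) < \<infinity>"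
  shows "M = N"
proof -
  define w where "w x = ennreal (exp_gap 1 2 x)" for x
  have w_borel [measurable]: "w \<in> borel_measurable borel" unfolding w_def by measurable
  define D where "D K = distr (density K w) borel (\<lambda>x. x)" for K
  have meas: "f \<in> borel_measurable K"
    if "sets K = sets (restrict_space borel {0::real<..})" "f \<in> borel_measurable borel" for K and f :: "real \<Rightarrow> ennreal"
    using borel_measurable_on_pos[OF that] .
  have id: "(\<lambda>x. x) \<in> borel_measurable (density K w)"
    if "sets K = sets (restrict_space borel {0::real<..})" for K
    using borel_measurable_on_pos[OF that, of "\<lambda>x. x"] by simp
  have nn_D: "(\<integral>\<^sup>+x. f x \<partial>D K) = (\<integral>\<^sup>+x. w x * f x \<partial>K)"
    if K: "sets K = sets (restrict_space borel {0::real<..})" and f: "f \<in> borel_measurable borel" for K f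
  proof -
    have "(\<integral>\<^sup>+x. f x \<partial>D K) = (\<integral>\<^sup>+x. f x \<partial>density K w)"
      unfolding D_def by (rule nn_integral_distr[OF id[OF K]]) (simp add: f)
    also have "\<dots> = (\<integral>\<^sup>+x. w x * f x \<partial>K)"
      by (rule nn_integral_density[OF meas[OF K w_borel] meas[OF K f]])
    finally show ?thesis .
  qed
  have laplace_D: "(\<integral>\<^sup>+x. ennreal (exp (- real n * x)) \<partial>D K) =
      (\<integral>\<^sup>+x. ennreal (exp_gap (real (Suc n)) (real (Suc (Suc n))) x) \<partial>K)"
    if K: "sets K = sets (restrict_space borel {0::real<..})" for K n
  proof (subst nn_D[OF K], measurable, rule nn_integral_cong)
    fix x
    have "exp_gap (real (Suc n)) (real (Suc (Suc n))) x = exp (- real n * x) * exp_gap 1 2 x"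
      by (simp add: exp_gap_def algebra_simps flip: exp_add)
    then show "w x * ennreal (exp (- real n * x)) = ennreal (exp_gap (real (Suc n)) (real (Suc (Suc n))) x)"
      by (simp add: w_def ennreal_mult'' mult.commute)
  qed
  have nonneg_D: "AE x in D K. 0 \<le> x" if K: "sets K = sets (restrict_space borel {0::real<..})" for K
    unfolding D_def by (subst AE_distr_iff[OF id[OF K]]) (auto intro!: AE_I2 simp: space_on_pos[OF K])
  have "D M = D N"
  proof (rule finite_measure_eq_of_laplace_eq)
    show "emeasure (D M) UNIV < \<infinity>"
      using fin laplace_D[OF sets(1), of 0] by (simp add: D_def numeral_2_eq_2)
    show "(\<integral>\<^sup>+x. ennreal (exp (- real n * x)) \<partial>D M) = (\<integral>\<^sup>+x. ennreal (exp (- real n * x)) \<partial>D N)" for n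
      unfolding laplace_D[OF sets(1)] laplace_D[OF sets(2)] by (rule eq) simp
    show "AE x in D M. 0 \<le> x" "AE x in D N. 0 \<le> x" by (intro nonneg_D sets)+
  qed (simp_all add: D_def)
  have w_inverse: "w x * inverse (w x) = 1" if "0 < x" for x
  proof -
    have "w x \<noteq> 0" "w x \<noteq> \<infinity>" using that by (auto simp: w_def exp_gap_def)
    then show ?thesis by (simp add: ennreal_divide_self divide_ennreal_def[symmetric] less_top)
  qed
  have recover: "emeasure K A = (\<integral>\<^sup>+x. inverse (w x) * indicator A x \<partial>D K)"
    if K: "sets K = sets (restrict_space borel {0::real<..})" and A: "A \<in> sets K" for K A
  proof -
    have A' [measurable]: "A \<in> sets borel" and A_pos: "A \<subseteq> {0<..}"
      using A unfolding K by (auto simp: sets_restrict_space_iff)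
    have "(\<integral>\<^sup>+x. inverse (w x) * indicator A x \<partial>D K) = (\<integral>\<^sup>+x. w x * (inverse (w x) * indicator A x) \<partial>K)"
      by (intro nn_D[OF K]) measurable
    also have "\<dots> = (\<integral>\<^sup>+x. indicator A x \<partial>K)"
      using A_pos w_inverse by (intro nn_integral_cong) (auto split: split_indicator)
    finally show ?thesis using A by simp
  qed
  show ?thesis
    using recover[OF sets(1)] recover[OF sets(2)] \<open>D M = D N\<close> sets by (intro measure_eqI) auto
qed

section \<open>The time change that linearises the cumulant flow\<close>

text \<open>
Cauchy's functional equation. Nonnegativity makes \<open>L\<close> increasing, so \<open>n L(t) = L(n t)\<close> lies
between \<open>k L(1)\<close> and \<open>(k + 1) L(1)\<close> for \<open>k = \<lfloor>n t\<rfloor>\<close>; dividing by \<open>n\<close> pins down \<open>L(t)\<close> as \<open>n\<close> grows.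
\<close>
lemma additive_nonneg_imp_linear:
  fixes L :: "real \<Rightarrow> real"
  assumes add: "\<And>s t. 0 \<le> s \<Longrightarrow> 0 \<le> t \<Longrightarrow> L (s + t) = L s + L t"
    and nonneg: "\<And>t. 0 \<le> t \<Longrightarrow> 0 \<le> L t"
    and t: "0 \<le> t"
  shows "L t = L 1 * t"
proof -
  have mult: "L (real n * s) = real n * L s" if "0 \<le> s" for n s
  proof (induction n)
    case 0
    show ?case using add[of 0 0] by simp
  next
    case (Suc n)
    then show ?case using add[of s "real n * s"] that by (simp add: algebra_simps)
  qed
  have mono: "L s \<le> L r" if "0 \<le> s" "s \<le> r" for s r
    using add[of s "r - s"] nonneg[of "r - s"] that by simp
  have bound: "real n * \<bar>L t - L 1 * t\<bar> \<le> L 1" for n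
  proof -
    define k where "k = nat \<lfloor>real n * t\<rfloor>"
    have k: "real k \<le> real n * t" "real n * t \<le> real (Suc k)"
      using t unfolding k_def by (auto simp: of_nat_nat) linarith
    have "real k * L 1 \<le> real n * L t" "real n * L t \<le> real (Suc k) * L 1"
      using mono[OF _ k(1)] mono[OF _ k(2)] mult[of 1 k] mult[of 1 "Suc k"] mult[OF t, of n] t
      by (auto simp del: of_nat_Suc)
    moreover have "real k * L 1 \<le> real n * t * L 1" "real n * t * L 1 \<le> real (Suc k) * L 1"
      using k nonneg[of 1] by (auto intro!: mult_right_mono simp del: of_nat_Suc)
    ultimately have "\<bar>real n * L t - real n * t * L 1\<bar> \<le> L 1"
      by (auto simp: abs_le_iff algebra_simps)
    then show ?thesis
      by (simp add: abs_mult_pos' algebra_simps flip: right_diff_distrib)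
  qed
  have "\<bar>L t - L 1 * t\<bar> = 0"
  proof (rule ccontr)
    assume "\<bar>L t - L 1 * t\<bar> \<noteq> 0"
    then obtain n where "L 1 < real n * \<bar>L t - L 1 * t\<bar>"
      using ex_less_of_nat_mult[of "\<bar>L t - L 1 * t\<bar>" "L 1"] by auto
    then show False using bound[of n] by simp
  qed
  then show ?thesis by simp
qed

lemma nn_integral_exp_tail:
  assumes "0 < q"
  shows "(\<integral>\<^sup>+x\<in>{c..}. ennreal (exp (- q * x)) \<partial>lborel) = ennreal (exp (- q * c) / q)"
proof -
  have "(\<integral>\<^sup>+x\<in>{c..}. ennreal (exp (- q * x)) \<partial>lborel) = ennreal (0 - (- exp (- q * c) / q))"
  proof (rule nn_integral_FTC_atLeast)
    have "filterlim (\<lambda>x. - q * x) at_bot at_top"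
      using assms by (intro filterlim_tendsto_neg_mult_at_bot[OF tendsto_const _ filterlim_ident]) auto
    then have "((\<lambda>x. exp (- q * x)) \<longlongrightarrow> 0) at_top"
      by (rule filterlim_compose[OF exp_at_bot])
    then show "((\<lambda>x. - exp (- q * x) / q) \<longlongrightarrow> 0) at_top"
      using tendsto_divide[OF tendsto_minus tendsto_const, of "\<lambda>x. exp (- q * x)" 0 at_top q] assms by simp
  qed (use assms in \<open>auto intro!: derivative_eq_intros\<close>)
  then show ?thesis by simp
qed

text \<open>
Positivity and continuity of \<open>\<psi>\<close> on \<open>(0, \<infinity>)\<close> and a linear bound near 0 are read off from the
representation of \<open>1 / \<psi>\<close> as the Laplace transform of a positive increasing function.
\<close>
locale scale_mechanism =
  fixes \<psi> W :: "real \<Rightarrow> real"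
  assumes psi_0: "\<psi> 0 = 0"
    and scale: "scale_function \<psi> W"
    and grey: "\<exists>a>0. set_integrable lborel {a..} (\<lambda>q. 1 / \<psi> q)"
begin

lemma W_pos: "0 < x \<Longrightarrow> 0 < W x"
  using scale unfolding scale_function_def strict_mono_on_def
  by (metis atLeast_iff less_eq_real_def order_le_less_trans order_refl)

lemma W_nonneg: "0 \<le> x \<Longrightarrow> 0 \<le> W x"
  using scale by (auto simp: scale_function_def)

lemma W_mono: "0 \<le> x \<Longrightarrow> x \<le> y \<Longrightarrow> W x \<le> W y"
  using scale unfolding scale_function_def strict_mono_on_def
  by (metis atLeast_iff less_eq_real_def order.trans)

lemma W_measurable [measurable]: "(\<lambda>x. indicator {0..} x * W x) \<in> borel_measurable borel"
  using borel_measurable_continuous_on_indicator[of "{0..}" W] scale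
  by (auto simp: scale_function_def)

lemma laplace_integrable:
  "0 < q \<Longrightarrow> integrable lborel (\<lambda>x. exp (- q * x) * (indicator {0..} x * W x))"
  using scale by (auto simp: scale_function_def set_integrable_def ac_simps)

lemma laplace_W: "0 < q \<Longrightarrow> (LINT x|lborel. exp (- q * x) * (indicator {0..} x * W x)) = 1 / \<psi> q"
  using scale by (auto simp: scale_function_def set_lebesgue_integral_def ac_simps)

lemma nn_laplace_W:
  "0 < q \<Longrightarrow> (\<integral>\<^sup>+x. ennreal (exp (- q * x) * (indicator {0..} x * W x)) \<partial>lborel) = ennreal (1 / \<psi> q)"
  using nn_integral_eq_integral[OF laplace_integrable, of q] laplace_W[of q] W_nonneg
  by (simp add: indicator_def)

text \<open>
The part of the Laplace integral over \<open>[1, \<infinity>)\<close>, with \<open>W\<close> replaced by its smallest value \<open>W(1)\<close> there.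
\<close>
lemma recip_psi_ge:
  assumes "0 < q"
  shows "W 1 * exp (- q) / q \<le> 1 / \<psi> q"
proof -
  have "ennreal (W 1 * exp (- q) / q) = ennreal (W 1) * (\<integral>\<^sup>+x\<in>{1..}. ennreal (exp (- q * x)) \<partial>lborel)"
    using nn_integral_exp_tail[OF assms, of 1] W_nonneg[of 1] by (simp flip: ennreal_mult')
  also have "\<dots> = (\<integral>\<^sup>+x\<in>{1..}. ennreal (W 1) * ennreal (exp (- q * x)) \<partial>lborel)"
    by (subst nn_integral_cmult[symmetric]) (auto simp: ac_simps)
  also have "\<dots> \<le> (\<integral>\<^sup>+x. ennreal (exp (- q * x) * (indicator {0..} x * W x)) \<partial>lborel)"
    using W_mono[of 1] W_nonneg[of 1]
    by (intro nn_integral_mono)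
       (auto split: split_indicator simp: ac_simps simp flip: ennreal_mult'' intro!: ennreal_leI mult_right_mono)
  finally have "ennreal (W 1 * exp (- q) / q) \<le> ennreal (1 / \<psi> q)"
    by (simp only: nn_laplace_W[OF assms])
  moreover have "0 < W 1 * exp (- q) / q" using assms W_pos[of 1] by simp
  ultimately show ?thesis
    by (smt (verit, best) ennreal_le_iff2)
qed

lemma psi_pos:
  assumes "0 < q" shows "0 < \<psi> q"
proof -
  have "0 < W 1 * exp (- q) / q" using assms W_pos[of 1] by simp
  then have "0 < 1 / \<psi> q" using recip_psi_ge[OF assms] by linarith
  then show ?thesis by simp
qed

text \<open>
This bound makes \<open>\<integral> dr / \<psi>(r)\<close> diverge at 0, which keeps the cumulant flow away from 0 in finite time.
\<close>
lemma psi_le_linear: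
  assumes "0 \<le> r" "r \<le> q"
  shows "\<psi> r \<le> exp q / W 1 * r"
proof (cases "r = 0")
  case False
  then have r: "0 < r" using assms by simp
  have "\<psi> r \<le> r * exp r / W 1"
    using recip_psi_ge[OF r] psi_pos[OF r] W_pos[of 1] r by (simp add: field_simps exp_minus)
  also have "\<dots> \<le> r * exp q / W 1"
    using assms W_pos[of 1] by (intro divide_right_mono mult_left_mono) auto
  finally show ?thesis by (simp add: mult.commute)
qed (simp add: psi_0)

text \<open>
As a positive mixture of the convex functions \<open>q \<mapsto> exp (- q x)\<close>, a Laplace transform is convex, hence
continuous on an open interval.
\<close>
lemma continuous_recip_psi: "continuous_on {0<..} (\<lambda>q. 1 / \<psi> q)"
proof (rule convex_on_continuous)
  show "convex_on {0<..} (\<lambda>q. 1 / \<psi> q)"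
  proof (rule convex_onI)
    fix t p q :: real assume t: "0 < t" "t < 1" and "p \<in> {0<..}" "q \<in> {0<..}"
    then have p: "0 < p" and q: "0 < q" by auto
    have r: "0 < (1 - t) * p + t * q" using t p q by (simp add: add_pos_pos)
    have "1 / \<psi> ((1 - t) * p + t * q)
        = (LINT x|lborel. exp (- ((1 - t) * p + t * q) * x) * (indicator {0..} x * W x))"
      using laplace_W[OF r] by simp
    also have "\<dots> \<le> (LINT x|lborel. (1 - t) * (exp (- p * x) * (indicator {0..} x * W x))
        + t * (exp (- q * x) * (indicator {0..} x * W x)))"
    proof (intro integral_mono)
      fix x :: real
      have "exp ((1 - t) * (- p * x) + t * (- q * x)) \<le> (1 - t) * exp (- p * x) + t * exp (- q * x)"
        using t convex_onD[OF exp_convex, of t "- p * x" "- q * x"] by simp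
      then have "exp (- ((1 - t) * p + t * q) * x) \<le> (1 - t) * exp (- p * x) + t * exp (- q * x)"
        by (simp add: algebra_simps)
      then have "exp (- ((1 - t) * p + t * q) * x) * (indicator {0..} x * W x) \<le>
          ((1 - t) * exp (- p * x) + t * exp (- q * x)) * (indicator {0..} x * W x)"
        by (rule mult_right_mono) (auto split: split_indicator intro: W_nonneg)
      then show "exp (- ((1 - t) * p + t * q) * x) * (indicator {0..} x * W x) \<le>
         (1 - t) * (exp (- p * x) * (indicator {0..} x * W x)) + t * (exp (- q * x) * (indicator {0..} x * W x))"
        by (simp add: algebra_simps)
    qed (use laplace_integrable[OF r] laplace_integrable[OF p] laplace_integrable[OF q] in auto)
    also have "\<dots> = (1 - t) * (1 / \<psi> p) + t * (1 / \<psi> q)"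
      using laplace_integrable[OF p] laplace_integrable[OF q] laplace_W[OF p] laplace_W[OF q] by simp
    finally show "1 / \<psi> ((1 - t) *\<^sub>R p + t *\<^sub>R q) \<le> (1 - t) * (1 / \<psi> p) + t * (1 / \<psi> q)" by simp
  qed simp
qed simp

lemma recip_psi_integrable:
  assumes "0 < q" shows "set_integrable lborel {q..} (\<lambda>r. 1 / \<psi> r)"
proof -
  obtain a where a: "0 < a" "set_integrable lborel {a..} (\<lambda>r. 1 / \<psi> r)" using grey by blast
  have "set_integrable lborel {q..a} (\<lambda>r. 1 / \<psi> r)"
    unfolding set_integrable_def
    by (intro borel_integrable_compact continuous_on_subset[OF continuous_recip_psi]) (use assms in auto)
  then have "set_integrable lborel ({q..a} \<union> {a..}) (\<lambda>r. 1 / \<psi> r)"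
    using a by (intro set_integrable_Un) auto
  then show ?thesis by (rule set_integrable_subset) auto
qed

text \<open>
The time that the flow started from infinity takes to come down to \<open>q\<close>.
\<close>
definition Phi :: "real \<Rightarrow> real" where
  "Phi q = (LINT r:{q..}|lborel. 1 / \<psi> r)"

lemma Phi_diff:
  assumes "0 < p" "p \<le> q"
  shows "Phi p = Phi q + integral {p..q} (\<lambda>r. 1 / \<psi> r)"
proof -
  have H: "((\<lambda>r. 1 / \<psi> r) has_integral Phi x) {x..}" if "0 < x" for x
    using set_borel_integral_eq_integral[OF recip_psi_integrable[OF that]]
    unfolding Phi_def by (simp add: integrable_integral)
  have "(\<lambda>r. 1 / \<psi> r) integrable_on {p..q}"
    by (intro integrable_continuous_interval continuous_on_subset[OF continuous_recip_psi]) (use assms in auto)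
  then have "((\<lambda>r. 1 / \<psi> r) has_integral (Phi q + integral {p..q} (\<lambda>r. 1 / \<psi> r))) ({q..} \<union> {p..q})"
    using assms by (intro has_integral_Un H integrable_integral) (auto simp: Int_atLeastAtMostR1 intro!: negligible_subset[OF negligible_sing[of q]])
  moreover have "{q..} \<union> {p..q} = {p..}" using assms by auto
  ultimately show ?thesis using H[OF assms(1)] has_integral_unique by auto
qed

text \<open>
The upper limit of integration is moved to \<open>q + 1\<close> to apply the fundamental theorem of calculus on a
compact interval; the remainder is constant.
\<close>
lemma Phi_DERIV:
  assumes q: "0 < q" shows "(Phi has_real_derivative - (1 / \<psi> q)) (at q)"
proof -
  have "((\<lambda>x. integral {x..q+1} (\<lambda>r. 1 / \<psi> r)) has_real_derivative - (1 / \<psi> q)) (at q within {q/2..q+1})"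
    by (intro integral_has_real_derivative' continuous_on_subset[OF continuous_recip_psi]) (use q in auto)
  then have "((\<lambda>x. Phi (q + 1) + integral {x..q+1} (\<lambda>r. 1 / \<psi> r)) has_real_derivative - (1 / \<psi> q)) (at q)"
  proof -
    assume D: "((\<lambda>x. integral {x..q+1} (\<lambda>r. 1 / \<psi> r)) has_real_derivative - (1 / \<psi> q)) (at q within {q/2..q+1})"
    have "at q within {q/2..q+1} = at q" by (rule at_within_interior) (use q in simp)
    with D have "((\<lambda>x. integral {x..q+1} (\<lambda>r. 1 / \<psi> r)) has_real_derivative - (1 / \<psi> q)) (at q)"
      by (simp only:)
    from DERIV_add[OF DERIV_const[of "Phi (q + 1)"] this] show ?thesis
      by (simp only: add_0)
  qed
  then show ?thesis
  proof (rule has_field_derivative_transform_within_open[where S = "{q/2<..<q+1}"])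
    fix x assume "x \<in> {q/2<..<q+1}"
    then show "Phi (q + 1) + integral {x..q+1} (\<lambda>r. 1 / \<psi> r) = Phi x"
      using q Phi_diff[of x "q + 1"] by simp
  qed (use q in auto)
qed

lemma Phi_less:
  assumes p: "0 < p" and "p < q" shows "Phi q < Phi p"
proof (rule DERIV_neg_imp_decreasing[OF \<open>p < q\<close>])
  fix x assume "p \<le> x"
  then have "0 < x" using p by simp
  then show "\<exists>y. (Phi has_real_derivative y) (at x) \<and> y < 0"
    using psi_pos by (intro exI[of _ "- (1 / \<psi> x)"] conjI Phi_DERIV) simp_all
qed

lemma Phi_less_iff: "0 < p \<Longrightarrow> 0 < q \<Longrightarrow> Phi q < Phi p \<longleftrightarrow> p < q"
  using Phi_less[of p q] Phi_less[of q p] by (cases p q rule: linorder_cases) auto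

lemma Phi_inj: "0 < p \<Longrightarrow> 0 < q \<Longrightarrow> Phi p = Phi q \<Longrightarrow> p = q"
  using Phi_less_iff[of p q] Phi_less_iff[of q p] by auto

lemma Phi_pos: assumes "0 < q" shows "0 < Phi q"
proof -
  have "0 \<le> Phi (q + 1)"
    unfolding Phi_def set_lebesgue_integral_def
    using psi_pos assms by (intro Bochner_Integration.integral_nonneg) (auto split: split_indicator intro: less_imp_le)
  then show ?thesis using Phi_less[of q "q + 1"] assms by simp
qed

text \<open>
Tonelli's theorem, with \<open>\<integral>\<^sub>q\<^sup>\<infinity> exp (- r x) dr = exp (- q x) / x\<close> for \<open>x > 0\<close>. In particular
\<open>exp (- q x)\<close> is integrable against \<open>W(x) / x dx\<close> for every \<open>q > 0\<close>.
\<close>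
lemma Phi_eq_laplace:
  assumes q: "0 < q"
  shows "(\<integral>\<^sup>+x\<in>{0<..}. ennreal (exp (- q * x) * (W x / x)) \<partial>lborel) = ennreal (Phi q)"
proof -
  have "ennreal (Phi q) = (\<integral>\<^sup>+r. ennreal (indicator {q..} r * (1 / \<psi> r)) \<partial>lborel)"
  proof -
    have "0 \<le> indicator {q..} r * (1 / \<psi> r)" for r
      using psi_pos[of r] q by (auto split: split_indicator)
    then show ?thesis
      using recip_psi_integrable[OF q] unfolding Phi_def set_lebesgue_integral_def set_integrable_def
      by (subst nn_integral_eq_integral) simp_all
  qed
  also have "\<dots> = (\<integral>\<^sup>+r. \<integral>\<^sup>+x. indicator {q..} r * ennreal (exp (- r * x) * (indicator {0..} x * W x)) \<partial>lborel \<partial>lborel)"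
  proof (intro nn_integral_cong)
    fix r :: real
    have "0 < r \<Longrightarrow> (\<integral>\<^sup>+x. 1 * ennreal (exp (- r * x) * (indicator {0..} x * W x)) \<partial>lborel) = ennreal (1 / \<psi> r)"
      by (simp only: nn_laplace_W mult_1)
    then show "ennreal (indicator {q..} r * (1 / \<psi> r)) =
        (\<integral>\<^sup>+x. indicator {q..} r * ennreal (exp (- r * x) * (indicator {0..} x * W x)) \<partial>lborel)"
      using q by (cases "q \<le> r") simp_all
  qed
  also have "\<dots> = (\<integral>\<^sup>+x. \<integral>\<^sup>+r. indicator {q..} r * ennreal (exp (- r * x) * (indicator {0..} x * W x)) \<partial>lborel \<partial>lborel)"
    by (rule lborel_pair.Fubini') measurable
  also have "\<dots> = (\<integral>\<^sup>+x\<in>{0<..}. ennreal (exp (- q * x) * (W x / x)) \<partial>lborel)"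
  proof (rule nn_integral_cong_AE)
    have "(\<integral>\<^sup>+r. indicator {q..} r * ennreal (exp (- r * x) * (indicator {0..} x * W x)) \<partial>lborel)
        = ennreal (exp (- q * x) * (W x / x)) * indicator {0<..} x" if "x \<noteq> 0" for x
    proof (cases "0 < x")
      case True
      have "(\<integral>\<^sup>+r. indicator {q..} r * ennreal (exp (- r * x) * (indicator {0..} x * W x)) \<partial>lborel)
          = (\<integral>\<^sup>+r. ennreal (W x) * (ennreal (exp (- x * r)) * indicator {q..} r) \<partial>lborel)"
      proof (intro nn_integral_cong)
        fix r :: real
        have "ennreal (exp (- r * x) * W x) = ennreal (W x) * ennreal (exp (- x * r))"
          using True W_nonneg[of x] by (simp add: mult.commute flip: ennreal_mult')
        then show "indicator {q..} r * ennreal (exp (- r * x) * (indicator {0..} x * W x)) =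
            ennreal (W x) * (ennreal (exp (- x * r)) * indicator {q..} r)"
          using True by (cases "q \<le> r") simp_all
      qed
      also have "\<dots> = ennreal (W x) * ennreal (exp (- x * q) / x)"
        by (subst nn_integral_cmult) (simp_all only: nn_integral_exp_tail[OF True], measurable)
      also have "\<dots> = ennreal (exp (- q * x) * (W x / x))"
        using True W_nonneg[of x] by (simp add: mult.commute flip: ennreal_mult')
      finally show ?thesis using True by simp
    qed (use that in auto)
    moreover have "AE x in lborel. x \<noteq> (0::real)" by (rule AE_lborel_singleton)
    ultimately show "AE x in lborel. (\<integral>\<^sup>+r. indicator {q..} r * ennreal (exp (- r * x) * (indicator {0..} x * W x)) \<partial>lborel)
        = ennreal (exp (- q * x) * (W x / x)) * indicator {0<..} x" by auto
  qed
  finally show ?thesis by simp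
qed

end

locale scale_flow = scale_mechanism +
  fixes u :: "real \<Rightarrow> real \<Rightarrow> real"
  assumes cumulant_flow: "cumulant_flow \<psi> u"
begin

lemma u_0: "0 < q \<Longrightarrow> u 0 q = q"
  using cumulant_flow by (auto simp: cumulant_flow_def)

lemma u_nonneg: "0 < q \<Longrightarrow> 0 \<le> t \<Longrightarrow> 0 \<le> u t q"
  using cumulant_flow by (auto simp: cumulant_flow_def)

lemma u_DERIV_within:
  "0 < q \<Longrightarrow> 0 \<le> t \<Longrightarrow> ((\<lambda>s. u s q) has_real_derivative - \<psi> (u t q)) (at t within {0..})"
  using cumulant_flow by (auto simp: cumulant_flow_def)

lemma u_DERIV: "0 < q \<Longrightarrow> 0 < t \<Longrightarrow> ((\<lambda>s. u s q) has_real_derivative - \<psi> (u t q)) (at t)"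
  using u_DERIV_within[of q t] at_within_interior[of t "{0..}"] by simp

lemma u_continuous: "0 < q \<Longrightarrow> continuous_on {0..t} (\<lambda>s. u s q)"
  by (rule continuous_on_subset[OF DERIV_continuous_on[OF u_DERIV_within]]) auto

lemma psi_nonneg: "0 \<le> q \<Longrightarrow> 0 \<le> \<psi> q"
  using psi_pos[of q] psi_0 by (cases "q = 0") auto

lemma u_le: assumes q: "0 < q" and t: "0 \<le> t" shows "u t q \<le> q"
proof (cases "t = 0")
  case False
  have "u t q \<le> u 0 q"
  proof (rule DERIV_nonpos_imp_decreasing_open[OF t])
    fix s assume s: "0 < s" "s < t"
    then show "\<exists>y. ((\<lambda>s. u s q) has_real_derivative y) (at s) \<and> y \<le> 0"
      using u_DERIV[OF q s(1)] psi_nonneg[OF u_nonneg[OF q, of s]] by auto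
  qed (rule u_continuous[OF q])
  then show ?thesis by (simp add: u_0 q)
qed (simp add: u_0 q)

text \<open>
As long as \<open>u\<^sub>t(q) \<le> q\<close>, the linear bound \<open>\<psi>(u) \<le> C u\<close> makes \<open>u\<^sub>t(q) exp (C t)\<close> increasing in \<open>t\<close>.
\<close>
lemma u_pos: assumes q: "0 < q" and t: "0 \<le> t" shows "0 < u t q"
proof (cases "t = 0")
  case False
  define C where "C = exp q / W 1"
  have "u 0 q * exp (C * 0) \<le> u t q * exp (C * t)"
  proof (rule DERIV_nonneg_imp_increasing_open[of 0 t "\<lambda>s. u s q * exp (C * s)"])
    fix s assume s: "0 < s" "s < t"
    have "((\<lambda>s. exp (C * s)) has_real_derivative exp (C * s) * C) (at s)"
      by (auto intro!: derivative_eq_intros)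
    from DERIV_mult[OF u_DERIV[OF q s(1)] this]
    have "((\<lambda>s. u s q * exp (C * s)) has_real_derivative (C * u s q - \<psi> (u s q)) * exp (C * s)) (at s)"
      by (simp add: algebra_simps)
    moreover have "0 \<le> (C * u s q - \<psi> (u s q)) * exp (C * s)"
      using psi_le_linear[of "u s q" q] u_nonneg[of q s] u_le[of q s] q s by (simp add: C_def)
    ultimately show "\<exists>y. ((\<lambda>s. u s q * exp (C * s)) has_real_derivative y) (at s) \<and> 0 \<le> y" by blast
  qed (use t in \<open>auto intro!: continuous_intros u_continuous q\<close>)
  then have "0 < u t q * exp (C * t)" using u_0[OF q] q by simp
  then show ?thesis by (simp add: zero_less_mult_iff)
qed (simp add: u_0 q)

text \<open>
The derivative of \<open>\<Phi>(u\<^sub>t(q))\<close> in \<open>t\<close> is \<open>- (1 / \<psi>(u)) (- \<psi>(u)) = 1\<close>. Monotonicity, the semigroup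
property and the range of the flow then all follow because \<open>\<Phi>\<close> is strictly decreasing.
\<close>
lemma Phi_u: assumes q: "0 < q" and t: "0 \<le> t" shows "Phi (u t q) = Phi q + t"
proof (cases "t = 0")
  case False
  have "Phi (u t q) - t = Phi (u 0 q) - 0"
  proof (rule DERIV_isconst_end[of 0 t "\<lambda>s. Phi (u s q) - s"])
    have "continuous_on {0<..} Phi"
      by (rule DERIV_continuous_on[OF has_field_derivative_at_within[OF Phi_DERIV]]) simp
    then show "continuous_on {0..t} (\<lambda>s. Phi (u s q) - s)"
      using q by (intro continuous_intros continuous_on_compose2[OF _ u_continuous]) (auto intro: u_pos)
    fix s assume s: "0 < s" "s < t"
    have "0 < u s q" using u_pos q s by simp
    then have "((\<lambda>s. Phi (u s q) - s) has_real_derivative - (1 / \<psi> (u s q)) * - \<psi> (u s q) - 1) (at s)"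
      by (intro DERIV_diff DERIV_chain2[OF Phi_DERIV u_DERIV] DERIV_ident q s)
    moreover have "- (1 / \<psi> (u s q)) * - \<psi> (u s q) - 1 = 0"
      using psi_pos[OF \<open>0 < u s q\<close>] by simp
    ultimately show "((\<lambda>s. Phi (u s q) - s) has_real_derivative 0) (at s)" by (simp only:)
  qed (use t False in auto)
  then show ?thesis by (simp add: u_0 q)
qed (simp add: u_0 q)

lemma u_strict_mono:
  assumes "0 < p" "p < q" "0 \<le> t" shows "u t p < u t q"
proof -
  have "Phi (u t q) < Phi (u t p)"
    using assms Phi_u[of p t] Phi_u[of q t] Phi_less[of p q] by simp
  then show ?thesis
    using Phi_less_iff[OF u_pos u_pos, of p t q t] assms by simp
qed

lemma u_add:
  assumes "0 < q" "0 \<le> s" "0 \<le> t" shows "u (s + t) q = u t (u s q)"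
proof (rule Phi_inj)
  have us: "0 < u s q" using assms by (intro u_pos)
  show "0 < u t (u s q)" "0 < u (s + t) q" using assms us by (auto intro: u_pos)
  show "Phi (u (s + t) q) = Phi (u t (u s q))"
    using Phi_u[of q "s + t"] Phi_u[of q s] Phi_u[OF us, of t] assms by simp
qed

lemma u_reaches:
  assumes "0 < p" "p \<le> q" shows "u (Phi p - Phi q) q = p"
proof -
  have t: "0 \<le> Phi p - Phi q" using Phi_less[of p q] assms by (cases "p = q") auto
  have q: "0 < q" using assms by simp
  show ?thesis
    by (rule Phi_inj[OF u_pos[OF q t] assms(1)]) (simp add: Phi_u[OF q t])
qed

text \<open>
The flow comes down from infinity, because \<open>\<Phi>\<close> is already positive at the starting point.
This is how Grey's condition yields extinction with positive probability.
\<close>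
lemma u_Phi_le: assumes "0 < p" "0 < q" shows "u (Phi p) q \<le> p"
proof -
  have "Phi p < Phi (u (Phi p) q)"
    using assms Phi_pos[of p] Phi_pos[of q] by (simp add: Phi_u)
  then show ?thesis
    using Phi_less_iff[of "u (Phi p) q" p] assms Phi_pos[of p] u_pos[of q "Phi p"] by simp
qed

end

section \<open>The transition kernel\<close>

text \<open>
\<open>D t x\<close> is the law at time \<open>t\<close> of the process started from \<open>x\<close>. Stationarity concerns only these
one-dimensional laws.
\<close>
locale branching_kernel = scale_flow +
  fixes D :: "real \<Rightarrow> real \<Rightarrow> real measure"
  assumes kernel: "0 \<le> t \<Longrightarrow> D t \<in> restrict_space borel {0..} \<rightarrow>\<^sub>M prob_algebra borel"
    and kernel_nonneg: "0 \<le> t \<Longrightarrow> 0 \<le> x \<Longrightarrow> AE z in D t x. 0 \<le> z"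
    and kernel_laplace:
      "0 \<le> t \<Longrightarrow> 0 \<le> x \<Longrightarrow> 0 < q \<Longrightarrow> (LINT z|D t x. exp (- q * z)) = exp (- x * u t q)"
begin

lemma prob_space_kernel: "0 \<le> t \<Longrightarrow> 0 \<le> x \<Longrightarrow> prob_space (D t x)"
  and sets_kernel: "0 \<le> t \<Longrightarrow> 0 \<le> x \<Longrightarrow> sets (D t x) = sets borel"
  using measurable_space[OF kernel, of t x] by (auto simp: space_prob_algebra space_restrict_space)

lemma space_kernel: "0 \<le> t \<Longrightarrow> 0 \<le> x \<Longrightarrow> space (D t x) = UNIV"
  using sets_kernel[THEN sets_eq_imp_space_eq] by simp

lemma kernel_exp_integrable:
  assumes "0 \<le> t" "0 \<le> x" "0 \<le> q" shows "integrable (D t x) (\<lambda>z. exp (- q * z))"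
proof -
  interpret prob_space "D t x" by (rule prob_space_kernel[OF assms(1,2)])
  have [measurable_cong]: "sets (D t x) = sets borel" by (rule sets_kernel[OF assms(1,2)])
  show ?thesis
    using kernel_nonneg[OF assms(1,2)] assms(3) by (intro integrable_const_bound[where B = 1]) auto
qed

lemma nn_kernel_laplace:
  assumes "0 \<le> t" "0 \<le> x" "0 < q"
  shows "(\<integral>\<^sup>+z. ennreal (exp (- q * z)) \<partial>D t x) = ennreal (exp (- x * u t q))"
  using nn_integral_eq_integral[OF kernel_exp_integrable[of t x q]] kernel_laplace[OF assms] assms by simp

text \<open>
A gap vanishes at 0, so discarding the mass absorbed there leaves its expectation unchanged, and
the two Laplace transforms can be subtracted.
\<close>
lemma kernel_exp_gap:
  assumes t: "0 \<le> t" and x: "0 \<le> x" and "0 < p" "p \<le> q"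
  shows "(\<integral>\<^sup>+z\<in>{0<..}. ennreal (exp_gap p q z) \<partial>D t x) = ennreal (exp_gap (u t p) (u t q) x)"
proof -
  have int: "integrable (D t x) (\<lambda>z. exp (- p * z))" "integrable (D t x) (\<lambda>z. exp (- q * z))"
    using assms(3,4) by (simp_all only: kernel_exp_integrable[OF t x] less_imp_le order.trans)
  have "(\<integral>\<^sup>+z\<in>{0<..}. ennreal (exp_gap p q z) \<partial>D t x) = (\<integral>\<^sup>+z. ennreal (exp_gap p q z) \<partial>D t x)"
  proof (rule nn_integral_cong_AE)
    have "ennreal (exp_gap p q z) * indicator {0<..} z = ennreal (exp_gap p q z)" if "0 \<le> z" for z
      using that by (cases "z = 0") (auto simp: exp_gap_def)
    then show "AE z in D t x. ennreal (exp_gap p q z) * indicator {0<..} z = ennreal (exp_gap p q z)"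
      using kernel_nonneg[OF t x] by auto
  qed
  also have "\<dots> = ennreal (LINT z|D t x. exp_gap p q z)"
  proof (rule nn_integral_eq_integral)
    show "integrable (D t x) (exp_gap p q)"
      unfolding exp_gap_def using int by (rule Bochner_Integration.integrable_diff)
    show "AE z in D t x. 0 \<le> exp_gap p q z"
      using kernel_nonneg[OF t x] exp_gap_nonneg[OF assms(4)] by auto
  qed
  also have "(LINT z|D t x. exp_gap p q z) = exp_gap (u t p) (u t q) x"
    unfolding exp_gap_def Bochner_Integration.integral_diff[OF int]
    using assms(3,4) by (simp only: kernel_laplace[OF t x] order.strict_trans2) (simp add: mult.commute)
  finally show ?thesis .
qed

text \<open>
Laplace transforms of the form \<open>exp (- x u)\<close> are multiplicative in \<open>x\<close>.
\<close>
lemma branching_property: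
  assumes t: "0 \<le> t" and x: "0 \<le> x" and y: "0 \<le> y"
  shows "D t (x + y) = (D t x \<star> D t y)"
proof -
  interpret X: prob_space "D t x" by (rule prob_space_kernel[OF t x])
  interpret Y: prob_space "D t y" by (rule prob_space_kernel[OF t y])
  have xy: "0 \<le> x + y" using x y by simp
  interpret XY: prob_space "D t (x + y)" by (rule prob_space_kernel[OF t xy])
  have sX [measurable_cong]: "sets (D t x) = sets borel" and sY [measurable_cong]: "sets (D t y) = sets borel"
    using sets_kernel t x y by auto
  have conv: "(\<integral>\<^sup>+z. f z \<partial>(D t x \<star> D t y)) = (\<integral>\<^sup>+a. \<integral>\<^sup>+b. f (a + b) \<partial>D t y \<partial>D t x)"
    if "f \<in> borel_measurable borel" for f
    by (rule nn_integral_convolution) (use that sX sY X.finite_measure_axioms Y.finite_measure_axioms in auto)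
  show ?thesis
  proof (rule finite_measure_eq_of_laplace_eq)
    show "AE z in D t (x + y). 0 \<le> z" by (rule kernel_nonneg[OF t xy])
    have "(\<integral>\<^sup>+z. indicator {..<0} z \<partial>(D t x \<star> D t y)) = (\<integral>\<^sup>+a. \<integral>\<^sup>+b. 0 \<partial>D t y \<partial>D t x)"
    proof (subst conv)
      have "AE a in D t x. (\<integral>\<^sup>+b. indicator {..<0} (a + b) \<partial>D t y) = 0"
        using kernel_nonneg[OF t x]
      proof eventually_elim
        case (elim a)
        have "AE b in D t y. indicator {..<0} (a + b) = (0::ennreal)"
          using kernel_nonneg[OF t y] by eventually_elim (use elim in auto)
        then have "(\<integral>\<^sup>+b. indicator {..<0} (a + b) \<partial>D t y) = (\<integral>\<^sup>+b. 0 \<partial>D t y)"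
          by (rule nn_integral_cong_AE)
        then show ?case by simp
      qed
      then show "(\<integral>\<^sup>+a. \<integral>\<^sup>+b. indicator {..<0} (a + b) \<partial>D t y \<partial>D t x) = (\<integral>\<^sup>+a. \<integral>\<^sup>+b. 0 \<partial>D t y \<partial>D t x)"
        by (intro nn_integral_cong_AE) simp
    qed simp
    then have "emeasure (D t x \<star> D t y) {..<0} = 0" by simp
    then show "AE z in (D t x \<star> D t y). 0 \<le> z"
      by (intro AE_I[of _ _ "{..<0}"]) auto
    show "emeasure (D t (x + y)) UNIV < \<infinity>"
      using XY.emeasure_space_1 space_kernel[OF t xy] by simp
    show "(\<integral>\<^sup>+z. ennreal (exp (- real n * z)) \<partial>D t (x + y)) =
        (\<integral>\<^sup>+z. ennreal (exp (- real n * z)) \<partial>(D t x \<star> D t y))" for n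
    proof (cases "n = 0")
      case True
      then show ?thesis
        using XY.emeasure_space_1 X.emeasure_space_1 Y.emeasure_space_1 conv[of "\<lambda>_. 1"] by simp
    next
      case False
      then have n: "0 < real n" by simp
      have "(\<integral>\<^sup>+z. ennreal (exp (- real n * z)) \<partial>(D t x \<star> D t y)) =
          (\<integral>\<^sup>+a. \<integral>\<^sup>+b. ennreal (exp (- real n * a)) * ennreal (exp (- real n * b)) \<partial>D t y \<partial>D t x)"
      proof (subst conv, measurable, intro nn_integral_cong)
        fix a b :: real
        have "exp (- real n * (a + b)) = exp (- real n * a) * exp (- real n * b)"
          by (simp add: algebra_simps flip: exp_add)
        then show "ennreal (exp (- real n * (a + b))) = ennreal (exp (- real n * a)) * ennreal (exp (- real n * b))"
          by (simp only: ennreal_mult'' exp_ge_zero)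
      qed
      also have "\<dots> = (\<integral>\<^sup>+a. ennreal (exp (- real n * a)) * ennreal (exp (- y * u t n)) \<partial>D t x)"
        by (subst nn_integral_cmult) (simp_all only: nn_kernel_laplace[OF t y n], measurable)
      also have "\<dots> = ennreal (exp (- x * u t n)) * ennreal (exp (- y * u t n))"
        by (subst nn_integral_multc) (simp_all only: nn_kernel_laplace[OF t x n], measurable)
      also have "\<dots> = ennreal (exp (- (x + y) * u t n))"
        by (simp add: algebra_simps flip: ennreal_mult'' exp_add)
      finally show ?thesis by (simp only: nn_kernel_laplace[OF t xy n])
    qed
  qed (simp_all add: sets_kernel[OF t xy])
qed

text \<open>
The probability of \<open>Z\<^sub>t = 0\<close> is the limit of the Laplace transform at infinity, that is of
\<open>exp (- x u\<^sub>t(n))\<close>.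
\<close>
lemma kernel_extinction_ge:
  assumes t: "0 \<le> t" and x: "0 \<le> x" and v: "\<And>q. 0 < q \<Longrightarrow> u t q \<le> v"
  shows "exp (- x * v) \<le> measure (D t x) {0}"
proof -
  interpret prob_space "D t x" by (rule prob_space_kernel[OF t x])
  have [measurable_cong]: "sets (D t x) = sets borel" by (rule sets_kernel[OF t x])
  have "(\<lambda>n. LINT z|D t x. exp (- real (Suc n) * z)) \<longlonglongrightarrow> (LINT z|D t x. indicator {0} z)"
  proof (rule integral_dominated_convergence[where w = "\<lambda>_. 1"])
    show "AE z in D t x. (\<lambda>n. exp (- real (Suc n) * z)) \<longlonglongrightarrow> indicator {0} z"
      using kernel_nonneg[OF t x]
    proof eventually_elim
      case (elim z)
      show ?case
      proof (cases "z = 0")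
        case False
        then have "(\<lambda>n. exp (- z) ^ Suc n) \<longlonglongrightarrow> 0"
          using elim by (intro LIMSEQ_Suc LIMSEQ_power_zero) auto
        moreover have "exp (- z) ^ Suc n = exp (- real (Suc n) * z)" for n
          using exp_of_nat_mult[of "Suc n" "- z"] by (simp only: mult_minus_left mult_minus_right)
        ultimately show ?thesis using False by (simp only: indicator_simps singleton_iff simp_thms)
      qed simp
    qed
    show "AE z in D t x. norm (exp (- real (Suc n) * z)) \<le> 1" for n
      using kernel_nonneg[OF t x] by eventually_elim (auto simp del: of_nat_Suc)
  qed auto
  then have lim: "(\<lambda>n. exp (- x * u t (real (Suc n)))) \<longlonglongrightarrow> measure (D t x) {0}"
    using kernel_laplace[OF t x] by (simp del: of_nat_Suc add: space_kernel[OF t x])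
  show ?thesis
    using v by (intro LIMSEQ_le_const[OF lim]) (auto intro!: exI[of _ 0] mult_left_mono x simp del: of_nat_Suc)
qed

text \<open>
At time \<open>t = \<Phi>(p)\<close> the flow is below \<open>p\<close>, so extinction has probability at least \<open>exp (- p x)\<close>. Let
\<open>K\<close> be the compact interval to be found.

For small \<open>x\<close>, a gap has expectation of order \<open>x\<close>. Outside \<open>K\<close> the gap is uniformly small, and it
vanishes at extinction, whose complement has probability at most \<open>p x\<close>; so the part outside \<open>K\<close> is a
small multiple of \<open>x\<close> and \<open>K\<close> must account for the rest. For \<open>x \<ge> 1\<close>, the branching property
splits off a unit of initial mass: it suffices that this unit leads into \<open>K\<close> while the rest,
of size \<open>x - 1\<close>, becomes extinct.
\<close>
lemma kernel_interval_ge: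
  assumes p: "0 < p"
  shows "\<exists>a b c. 0 < a \<and> 0 < c \<and>
    (\<forall>x. 0 < x \<longrightarrow> x \<le> 1 \<longrightarrow> c * x \<le> measure (D (Phi p) x) {a..b}) \<and>
    (\<forall>x\<ge>1. c * exp (- p * x) \<le> measure (D (Phi p) x) {a..b})"
proof -
  define t where "t = Phi p"
  have t: "0 \<le> t" unfolding t_def using Phi_pos[OF p] by simp
  have u_le_p: "u t q \<le> p" if "0 < q" for q unfolding t_def by (rule u_Phi_le[OF p that])
  define r s where "r = u t 1" and "s = u t 2"
  have rs: "0 < r" "r < s" "s \<le> p"
    unfolding r_def s_def using u_pos t u_strict_mono u_le_p by auto
  \<comment> \<open>Half of the lower bound \<open>(s - r) exp (- s) x\<close> for the expected gap is lost outside the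
    interval, where the gap is at most \<open>\<delta>\<close>: near 0 by linearity, beyond \<open>b\<close> by decay.\<close>
  define \<delta> where "\<delta> = (s - r) * exp (- s) / (2 * p)"
  define b where "b = - ln \<delta>"
  have \<delta>: "0 < \<delta>" using rs p by (simp add: \<delta>_def)
  have extinct: "exp (- x * p) \<le> measure (D t x) {0}" if "0 \<le> x" for x
    by (rule kernel_extinction_ge[OF t that u_le_p])
  have small: "\<delta> * p * x \<le> measure (D t x) {\<delta>..b}" if x: "0 < x" "x \<le> 1" for x
  proof -
    have x0: "0 \<le> x" using x by simp
    interpret prob_space "D t x" by (rule prob_space_kernel[OF t x0])
    have [measurable_cong]: "sets (D t x) = sets borel" by (rule sets_kernel[OF t x0])
    have pointwise: "ennreal (exp_gap 1 2 z) * indicator {0<..} z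
        \<le> ennreal (indicator {\<delta>..b} z + \<delta> * (1 - indicator {0} z))" if "0 \<le> z" for z
    proof -
      consider "z = 0" | "0 < z" "z < \<delta>" | "\<delta> \<le> z" "z \<le> b" | "0 < z" "\<delta> \<le> z" "b < z"
        using \<open>0 \<le> z\<close> by fastforce
      then have "exp_gap 1 2 z \<le> indicator {\<delta>..b} z + \<delta> * (1 - indicator {0} z)"
      proof cases
        case 2
        then show ?thesis using exp_gap_le_linear[of 1 2 z] by (auto split: split_indicator)
      next
        case 3
        have "exp (- 1 * z) \<le> 1" using \<open>0 \<le> z\<close> by simp
        then have "exp_gap 1 2 z \<le> 1" using exp_gap_le_exp[of 1 2 z] by linarith
        then show ?thesis using 3 \<delta> by (auto split: split_indicator)
      next
        case 4
        have "exp (- z) \<le> exp (ln \<delta>)" using 4(3) by (simp add: b_def)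
        then show ?thesis using 4 \<delta> exp_gap_le_exp[of 1 2 z] by (auto split: split_indicator)
      qed (auto simp: exp_gap_def split: split_indicator)
      then have "ennreal (exp_gap 1 2 z) \<le> ennreal (indicator {\<delta>..b} z + \<delta> * (1 - indicator {0} z))"
        by (rule ennreal_leI)
      then show ?thesis by (cases "0 < z") simp_all
    qed
    have "ennreal (exp_gap r s x) = (\<integral>\<^sup>+z\<in>{0<..}. ennreal (exp_gap 1 2 z) \<partial>D t x)"
      unfolding r_def s_def by (rule kernel_exp_gap[symmetric, OF t x0]) simp_all
    also have "\<dots> \<le> (\<integral>\<^sup>+z. ennreal (indicator {\<delta>..b} z + \<delta> * (1 - indicator {0} z)) \<partial>D t x)"
      using kernel_nonneg[OF t x0] by (intro nn_integral_mono_AE) (auto intro: pointwise)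
    also have "\<dots> = ennreal (LINT z|D t x. indicator {\<delta>..b} z + \<delta> * (1 - indicator {0} z))"
      using \<delta> by (intro nn_integral_eq_integral integrable_const_bound[where B = "1 + \<delta>"])
        (auto intro!: AE_I2 split: split_indicator)
    also have "(LINT z|D t x. indicator {\<delta>..b} z + \<delta> * (1 - indicator {0} z))
        = measure (D t x) {\<delta>..b} + \<delta> * (1 - measure (D t x) {0})"
      using prob_space by (simp add: space_kernel[OF t x0] emeasure_eq_measure)
    finally have "exp_gap r s x \<le> measure (D t x) {\<delta>..b} + \<delta> * (1 - measure (D t x) {0})"
      using \<delta> prob_le_1[of "{0}"] by (subst (asm) ennreal_le_iff) auto
    moreover have "2 * (\<delta> * p * x) \<le> exp_gap r s x"
      using exp_gap_ge_linear[of r s x] rs x p by (simp add: \<delta>_def)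
    moreover have "\<delta> * (1 - measure (D t x) {0}) \<le> \<delta> * (p * x)"
    proof (intro mult_left_mono)
      have "1 - p * x \<le> exp (- x * p)" using exp_ge_add_one_self[of "- x * p"] by (simp add: mult.commute)
      then show "1 - measure (D t x) {0} \<le> p * x" using extinct[OF x0] by linarith
    qed (use \<delta> in simp)
    ultimately show ?thesis by (simp add: mult.assoc)
  qed
  have large: "\<delta> * p * exp (- p * x) \<le> measure (D t x) {\<delta>..b}" if x: "1 \<le> x" for x
  proof -
    have x': "0 \<le> x - 1" and x0: "0 \<le> x" using x by auto
    interpret X: prob_space "D t x" by (rule prob_space_kernel[OF t x0])
    interpret X': prob_space "D t (x - 1)" by (rule prob_space_kernel[OF t x'])
    interpret One: prob_space "D t 1" by (rule prob_space_kernel[OF t]) simp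
    have [measurable_cong]: "sets (D t (x - 1)) = sets borel" "sets (D t 1) = sets borel"
      using sets_kernel t x' by auto
    have "emeasure (D t 1) {\<delta>..b} * emeasure (D t (x - 1)) {0} =
        (\<integral>\<^sup>+y. \<integral>\<^sup>+z. indicator {\<delta>..b} y * indicator {0} z \<partial>D t (x - 1) \<partial>D t 1)"
      by (simp add: nn_integral_cmult nn_integral_multc)
    also have "\<dots> \<le> (\<integral>\<^sup>+y. \<integral>\<^sup>+z. indicator {\<delta>..b} (y + z) \<partial>D t (x - 1) \<partial>D t 1)"
      by (intro nn_integral_mono) (auto split: split_indicator)
    also have "\<dots> = emeasure (D t 1 \<star> D t (x - 1)) {\<delta>..b}"
      by (rule convolution_emeasure'[symmetric])
        (use One.finite_measure_axioms X'.finite_measure_axioms sets_kernel[OF t] x' in auto)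
    also have "(D t 1 \<star> D t (x - 1)) = D t x"
      using branching_property[OF t _ x', of 1] by simp
    finally have "measure (D t 1) {\<delta>..b} * measure (D t (x - 1)) {0} \<le> measure (D t x) {\<delta>..b}"
      by (simp add: X.emeasure_eq_measure X'.emeasure_eq_measure One.emeasure_eq_measure flip: ennreal_mult'')
    moreover have "\<delta> * p * exp (- p * x) \<le> measure (D t 1) {\<delta>..b} * measure (D t (x - 1)) {0}"
    proof (intro mult_mono)
      have "exp (- p * x) \<le> exp (- (x - 1) * p)" using p by (simp add: algebra_simps)
      then show "exp (- p * x) \<le> measure (D t (x - 1)) {0}" using extinct[OF x'] by linarith
    qed (use small[of 1] in auto)
    ultimately show ?thesis by linarith
  qed
  show ?thesis
    using \<delta> p small large unfolding t_def
    by (intro exI[of _ \<delta>] exI[of _ b] exI[of _ "\<delta> * p"]) simp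
qed

section \<open>Stationary measures\<close>

definition stationary :: "real measure \<Rightarrow> bool" where
  "stationary \<nu> \<longleftrightarrow> radon_on_pos \<nu> \<and>
     (\<forall>t>0. \<forall>A\<in>sets borel. A \<subseteq> {0<..} \<longrightarrow> (\<integral>\<^sup>+x. emeasure (D t x) A \<partial>\<nu>) = emeasure \<nu> A)"

lemma kernel_measurable_on_pos:
  assumes t: "0 \<le> t" and \<nu>: "sets \<nu> = sets (restrict_space borel {0::real<..})"
  shows "D t \<in> measurable \<nu> (subprob_algebra borel)"
proof -
  have "D t \<in> restrict_space borel {0<..} \<rightarrow>\<^sub>M subprob_algebra borel"
    by (rule measurable_restrict_mono[OF measurable_prob_algebraD[OF kernel[OF t]]]) auto
  then show ?thesis using measurable_cong_sets[OF \<nu> refl] by blast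
qed

text \<open>
Transport by the kernel with the mass absorbed at 0 discarded, so that stationarity is the
fixed point equation \<open>evolve t \<nu> = \<nu>\<close>.
\<close>
definition evolve :: "real \<Rightarrow> real measure \<Rightarrow> real measure" where
  "evolve t \<nu> = restrict_space (\<nu> \<bind> D t) {0<..}"

lemma
  assumes t: "0 \<le> t" and \<nu>: "sets \<nu> = sets (restrict_space borel {0::real<..})"
  shows sets_evolve: "sets (evolve t \<nu>) = sets (restrict_space borel {0<..})"
    and emeasure_evolve: "A \<in> sets borel \<Longrightarrow> A \<subseteq> {0<..} \<Longrightarrow>
      emeasure (evolve t \<nu>) A = (\<integral>\<^sup>+x. emeasure (D t x) A \<partial>\<nu>)"
    and nn_integral_evolve: "f \<in> borel_measurable borel \<Longrightarrow>
      (\<integral>\<^sup>+x. f x \<partial>evolve t \<nu>) = (\<integral>\<^sup>+x. (\<integral>\<^sup>+z\<in>{0<..}. f z \<partial>D t x) \<partial>\<nu>)"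
proof -
  note K = kernel_measurable_on_pos[OF t \<nu>]
  have ne: "space \<nu> \<noteq> {}" by (auto simp: space_on_pos[OF \<nu>] intro!: exI[of _ 1])
  have sb: "sets (\<nu> \<bind> D t) = sets borel"
    using ne sets_kernel[OF t] by (intro sets_bind) (auto simp: space_on_pos[OF \<nu>])
  have pb: "{0<..} \<inter> space (\<nu> \<bind> D t) \<in> sets (\<nu> \<bind> D t)"
    using sets_eq_imp_space_eq[OF sb] by (simp add: sb)
  show "sets (evolve t \<nu>) = sets (restrict_space borel {0<..})"
    unfolding evolve_def by (rule sets_restrict_space_cong[OF sb])
  show "emeasure (evolve t \<nu>) A = (\<integral>\<^sup>+x. emeasure (D t x) A \<partial>\<nu>)" if "A \<in> sets borel" "A \<subseteq> {0<..}"
    unfolding evolve_def using that by (simp add: emeasure_restrict_space[OF pb] emeasure_bind[OF ne K])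
  show "(\<integral>\<^sup>+x. f x \<partial>evolve t \<nu>) = (\<integral>\<^sup>+x. (\<integral>\<^sup>+z\<in>{0<..}. f z \<partial>D t x) \<partial>\<nu>)" if [measurable]: "f \<in> borel_measurable borel"
    unfolding evolve_def nn_integral_restrict_space[OF pb] by (rule nn_integral_bind[OF _ K]) measurable
qed

lemma evolve_exp_gap:
  assumes t: "0 \<le> t" and \<nu>: "sets \<nu> = sets (restrict_space borel {0::real<..})" and "0 < p" "p \<le> q"
  shows "(\<integral>\<^sup>+x. ennreal (exp_gap p q x) \<partial>evolve t \<nu>) = (\<integral>\<^sup>+x. ennreal (exp_gap (u t p) (u t q) x) \<partial>\<nu>)"
  using assms(3,4)
  by (subst nn_integral_evolve[OF t \<nu>]) (auto intro!: nn_integral_cong kernel_exp_gap[OF t] simp: space_on_pos[OF \<nu>])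

lemma stationary_iff:
  "stationary \<nu> \<longleftrightarrow> radon_on_pos \<nu> \<and> (\<forall>t>0. evolve t \<nu> = \<nu>)"
proof (cases "radon_on_pos \<nu>")
  case True
  then have \<nu>: "sets \<nu> = sets (restrict_space borel {0<..})" by (simp add: radon_on_pos_def)
  have "evolve t \<nu> = \<nu> \<longleftrightarrow> (\<forall>A\<in>sets borel. A \<subseteq> {0<..} \<longrightarrow> (\<integral>\<^sup>+x. emeasure (D t x) A \<partial>\<nu>) = emeasure \<nu> A)"
    if "0 < t" for t
  proof
    assume "evolve t \<nu> = \<nu>"
    then show "\<forall>A\<in>sets borel. A \<subseteq> {0<..} \<longrightarrow> (\<integral>\<^sup>+x. emeasure (D t x) A \<partial>\<nu>) = emeasure \<nu> A"
      using emeasure_evolve[OF _ \<nu>, of t] that by simp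
  next
    assume A: "\<forall>A\<in>sets borel. A \<subseteq> {0<..} \<longrightarrow> (\<integral>\<^sup>+x. emeasure (D t x) A \<partial>\<nu>) = emeasure \<nu> A"
    show "evolve t \<nu> = \<nu>"
    proof (rule measure_eqI)
      show "sets (evolve t \<nu>) = sets \<nu>" using sets_evolve[OF _ \<nu>, of t] that \<nu> by simp
      fix B assume "B \<in> sets (evolve t \<nu>)"
      then have "B \<in> sets borel" "B \<subseteq> {0<..}"
        using sets_evolve[OF _ \<nu>, of t] that by (auto simp: sets_restrict_space_iff)
      then show "emeasure (evolve t \<nu>) B = emeasure \<nu> B"
        using A emeasure_evolve[OF _ \<nu>, of t B] that by simp
    qed
  qed
  then show ?thesis using True by (simp add: stationary_def)
qed (simp add: stationary_def)

text \<open>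
The gap of \<open>(p, q)\<close> is at most \<open>(q - p) x\<close> and at most \<open>exp (- p x)\<close>. These are the two orders,
near 0 and near infinity, in the lower bound for the probability of a compact
interval \<open>K\<close>; integrating that bound against \<open>\<nu>\<close> and using stationarity leaves a multiple of \<open>\<nu>(K)\<close>.
\<close>
lemma stationary_exp_gap_finite:
  assumes \<nu>: "stationary \<nu>" and p: "0 < p" and pq: "p \<le> q"
  shows "(\<integral>\<^sup>+x. ennreal (exp_gap p q x) \<partial>\<nu>) < \<infinity>"
proof -
  have sets: "sets \<nu> = sets (restrict_space borel {0<..})"
    and compact: "compact K \<Longrightarrow> K \<subseteq> {0<..} \<Longrightarrow> emeasure \<nu> K < \<infinity>" for K
    using \<nu> by (auto simp: stationary_def radon_on_pos_def)
  obtain a b c where abc: "0 < a" "0 < c"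
    and small: "\<And>x. 0 < x \<Longrightarrow> x \<le> 1 \<Longrightarrow> c * x \<le> measure (D (Phi p) x) {a..b}"
    and large: "\<And>x. 1 \<le> x \<Longrightarrow> c * exp (- p * x) \<le> measure (D (Phi p) x) {a..b}"
    using kernel_interval_ge[OF p] by blast
  have t: "0 < Phi p" by (rule Phi_pos[OF p])
  have ab: "{a..b} \<subseteq> {0<..}" using abc(1) by auto
  define C where "C = (q - p + 1) / c"
  have C: "0 \<le> C" using abc pq by (simp add: C_def)
  have bound: "exp_gap p q x \<le> C * measure (D (Phi p) x) {a..b}" if x: "0 < x" for x
  proof (cases "x \<le> 1")
    case True
    have "exp_gap p q x \<le> (q - p + 1) * x"
      using exp_gap_le_linear[of p q x] p pq x by (simp add: algebra_simps)
    also have "\<dots> = C * (c * x)" using abc by (simp add: C_def)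
    also have "\<dots> \<le> C * measure (D (Phi p) x) {a..b}" by (intro mult_left_mono small x True C)
    finally show ?thesis .
  next
    case False
    have "exp_gap p q x \<le> 1 * exp (- p * x)" using exp_gap_le_exp[of p q x] by simp
    also have "\<dots> \<le> (q - p + 1) * exp (- p * x)" using pq by (intro mult_right_mono) auto
    also have "\<dots> = C * (c * exp (- p * x))" using abc by (simp add: C_def)
    also have "\<dots> \<le> C * measure (D (Phi p) x) {a..b}" using False by (intro mult_left_mono large C) simp
    finally show ?thesis .
  qed
  have "(\<integral>\<^sup>+x. ennreal (exp_gap p q x) \<partial>\<nu>) \<le> (\<integral>\<^sup>+x. ennreal C * emeasure (D (Phi p) x) {a..b} \<partial>\<nu>)"
  proof (rule nn_integral_mono)
    fix x assume "x \<in> space \<nu>"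
    then have x: "0 < x" by (simp add: space_on_pos[OF sets])
    interpret prob_space "D (Phi p) x" using prob_space_kernel t x by simp
    show "ennreal (exp_gap p q x) \<le> ennreal C * emeasure (D (Phi p) x) {a..b}"
      using bound[OF x] C by (simp add: emeasure_eq_measure ennreal_leI flip: ennreal_mult'')
  qed
  also have "\<dots> = ennreal C * (\<integral>\<^sup>+x. emeasure (D (Phi p) x) {a..b} \<partial>\<nu>)"
    using measurable_compose[OF kernel_measurable_on_pos[OF less_imp_le[OF t] sets]
        measurable_emeasure_subprob_algebra[of "{a..b}" borel]]
    by (intro nn_integral_cmult) simp
  also have "(\<integral>\<^sup>+x. emeasure (D (Phi p) x) {a..b} \<partial>\<nu>) = emeasure \<nu> {a..b}"
    using \<nu> t ab unfolding stationary_def by simp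
  also have "ennreal C * emeasure \<nu> {a..b} < \<infinity>"
    using compact[OF _ ab] by (simp add: ennreal_mult_less_top)
  finally show ?thesis .
qed

text \<open>
Let \<open>G(p, q)\<close> be the \<open>\<nu>\<close>-integral of the gap. For fixed \<open>q\<close>, stationarity and the semigroup property make \<open>t \<mapsto> G(u\<^sub>t(q), q)\<close> additive and
nonnegative, hence linear. Every \<open>p \<le> q\<close> is \<open>u\<^sub>t(q)\<close> at time \<open>t = \<Phi>(p) - \<Phi>(q)\<close>. The slope is the same
for all \<open>q\<close> because the flow from \<open>q\<close> runs through every smaller \<open>p\<close>.
\<close>
lemma stationary_exp_gap:
  assumes \<nu>: "stationary \<nu>"
  obtains c where "0 \<le> c"
    "\<And>p q. 0 < p \<Longrightarrow> p \<le> q \<Longrightarrow> (\<integral>\<^sup>+x. ennreal (exp_gap p q x) \<partial>\<nu>) = ennreal (c * (Phi p - Phi q))"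
proof -
  have sets: "sets \<nu> = sets (restrict_space borel {0<..})"
    and invariant: "\<And>t. 0 < t \<Longrightarrow> evolve t \<nu> = \<nu>"
    using \<nu> by (auto simp: stationary_iff radon_on_pos_def)
  define G where "G p q = (LINT x|\<nu>. exp_gap p q x)" for p q
  have nonneg: "AE x in \<nu>. 0 \<le> exp_gap p q x" if "p \<le> q" for p q
    using that by (intro AE_I2) (auto simp: space_on_pos[OF sets] intro: exp_gap_nonneg)
  have int: "integrable \<nu> (exp_gap p q)" if "0 < p" "p \<le> q" for p q
    using stationary_exp_gap_finite[OF \<nu> that] nonneg[OF that(2)]
    by (intro integrableI_nonneg borel_measurable_on_pos[OF sets]) auto
  have nn_G: "(\<integral>\<^sup>+x. ennreal (exp_gap p q x) \<partial>\<nu>) = ennreal (G p q)" if "0 < p" "p \<le> q" for p q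
    unfolding G_def by (rule nn_integral_eq_integral[OF int[OF that] nonneg[OF that(2)]])
  have G_nonneg: "0 \<le> G p q" if "p \<le> q" for p q
    unfolding G_def by (rule integral_nonneg_AE[OF nonneg[OF that]])
  have G_add: "G p r = G p q + G q r" if "0 < p" "p \<le> q" "q \<le> r" for p q r
  proof -
    have "G p q + G q r = (LINT x|\<nu>. exp_gap p q x + exp_gap q r x)"
      unfolding G_def using that int[of p q] int[of q r] by simp
    then show ?thesis by (simp add: G_def exp_gap_def)
  qed
  have u_mono: "u t p \<le> u t q" if "0 < p" "p \<le> q" "0 \<le> t" for t p q
    using u_strict_mono[of p q t] that by (cases "p = q") auto
  have G_u: "G (u t p) (u t q) = G p q" if "0 < p" "p \<le> q" "0 \<le> t" for t p q
  proof (cases "t = 0")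
    case False
    then have "ennreal (G (u t p) (u t q)) = ennreal (G p q)"
      using that nn_G[of p q] nn_G[of "u t p" "u t q"] u_mono[of p q t] u_pos[of p t]
        evolve_exp_gap[OF _ sets, of t p q] invariant[of t] by simp
    then show ?thesis
      using G_nonneg that u_mono by (simp add: ennreal_inj)
  qed (use that in \<open>simp add: u_0\<close>)
  define rate where "rate q = G (u 1 q) q" for q
  have G_line: "G (u t q) q = rate q * t" if q: "0 < q" and t: "0 \<le> t" for q t
    unfolding rate_def
  proof (rule additive_nonneg_imp_linear[where L = "\<lambda>t. G (u t q) q"])
    fix s t :: real assume st: "0 \<le> s" "0 \<le> t"
    have us: "0 < u s q" "u s q \<le> q" using u_pos u_le q st by auto
    have ut: "0 < u t (u s q)" "u t (u s q) \<le> u t q" using u_pos u_mono us st by auto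
    have "G (u (s + t) q) q = G (u t (u s q)) (u t q) + G (u t q) q"
      using G_add[OF ut u_le[OF q st(2)]] by (simp only: u_add[OF q st])
    then show "G (u (s + t) q) q = G (u s q) q + G (u t q) q"
      using G_u[OF us st(2)] by simp
  qed (use t q G_nonneg u_le in auto)
  have G_Phi: "G p q = rate q * (Phi p - Phi q)" if "0 < p" "p \<le> q" for p q
  proof -
    have "0 \<le> Phi p - Phi q" using Phi_less[of p q] that by (cases "p = q") auto
    then show ?thesis using G_line[of q "Phi p - Phi q"] u_reaches[OF that] that by simp
  qed
  have rate_eq: "rate p = rate q" if "0 < p" "p \<le> q" for p q
  proof -
    have u1: "0 < u 1 p" "u 1 p \<le> p" using u_pos u_le that by auto
    have "rate p = G (u 1 p) q - G p q"
      unfolding rate_def using G_add[OF u1 that(2)] by simp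
    also have "\<dots> = rate q * (Phi (u 1 p) - Phi q) - rate q * (Phi p - Phi q)"
      using G_Phi[of "u 1 p" q] G_Phi[of p q] u1 that by simp
    also have "\<dots> = rate q * (Phi (u 1 p) - Phi p)" by (simp add: algebra_simps)
    finally show ?thesis using Phi_u[of p 1] that by simp
  qed
  show ?thesis
  proof (rule that[of "rate 1"])
    show "0 \<le> rate 1" unfolding rate_def by (rule G_nonneg[OF u_le]) auto
    fix p q :: real assume pq: "0 < p" "p \<le> q"
    have "rate q = rate 1" using rate_eq[of q 1] rate_eq[of 1 q] pq by (cases "q \<le> 1") auto
    then show "(\<integral>\<^sup>+x. ennreal (exp_gap p q x) \<partial>\<nu>) = ennreal (rate 1 * (Phi p - Phi q))"
      using nn_G[OF pq] G_Phi[OF pq] by simp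
  qed
qed

definition \<mu> :: "real measure" where
  "\<mu> = density (restrict_space lborel {0<..}) (\<lambda>x. ennreal (W x / x))"

lemma sets_mu: "sets \<mu> = sets (restrict_space borel {0<..})"
  by (simp add: \<mu>_def cong: sets_restrict_space_cong)

text \<open>
\<open>W\<close> is unconstrained on the negative half-line, so the density is first replaced by one that
vanishes there.
\<close>
lemma density_measurable: "(\<lambda>x. ennreal (W x / x)) \<in> borel_measurable (restrict_space lborel {0<..})"
proof -
  have "(\<lambda>x. ennreal (indicator {0..} x * W x / x)) \<in> borel_measurable (restrict_space lborel {0<..})"
    by (intro measurable_restrict_space1) measurable
  then show ?thesis
    by (rule measurable_cong[THEN iffD1, rotated]) (simp add: space_restrict_space)
qed

lemma mu_laplace:
  assumes q: "0 < q" shows "(\<integral>\<^sup>+x. ennreal (exp (- q * x)) \<partial>\<mu>) = ennreal (Phi q)"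
proof -
  have "(\<integral>\<^sup>+x. ennreal (exp (- q * x)) \<partial>\<mu>) =
      (\<integral>\<^sup>+x. ennreal (W x / x) * ennreal (exp (- q * x)) \<partial>restrict_space lborel {0<..})"
    unfolding \<mu>_def by (rule nn_integral_density[OF density_measurable]) (intro measurable_restrict_space1, measurable)
  also have "\<dots> = (\<integral>\<^sup>+x\<in>{0<..}. ennreal (exp (- q * x) * (W x / x)) \<partial>lborel)"
  proof (subst nn_integral_restrict_space, simp, rule nn_integral_cong)
    fix x :: real
    have "ennreal (exp (- q * x) * (W x / x)) = ennreal (W x / x) * ennreal (exp (- q * x))"
      by (subst mult.commute) (rule ennreal_mult'', simp)
    then show "ennreal (W x / x) * ennreal (exp (- q * x)) * indicator {0<..} x =
        ennreal (exp (- q * x) * (W x / x)) * indicator {0<..} x" by (simp only:)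
  qed
  finally show ?thesis by (simp only: Phi_eq_laplace[OF q])
qed

lemma mu_exp_gap:
  assumes "0 < p" "p \<le> q"
  shows "(\<integral>\<^sup>+x. ennreal (exp_gap p q x) \<partial>\<mu>) = ennreal (Phi p - Phi q)"
proof -
  have meas: "(\<lambda>x. ennreal (exp (- r * x))) \<in> borel_measurable \<mu>" for r
    by (rule borel_measurable_on_pos[OF sets_mu]) measurable
  have "(\<integral>\<^sup>+x. ennreal (exp_gap p q x) \<partial>\<mu>) = (\<integral>\<^sup>+x. ennreal (exp (- p * x)) - ennreal (exp (- q * x)) \<partial>\<mu>)"
    by (intro nn_integral_cong) (simp add: exp_gap_def ennreal_minus)
  also have "\<dots> = ennreal (Phi p) - ennreal (Phi q)"
    using assms
    by (subst nn_integral_diff[OF meas meas])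
       (auto simp: mu_laplace[simplified] space_on_pos[OF sets_mu] intro!: AE_I2 ennreal_leI)
  also have "\<dots> = ennreal (Phi p - Phi q)"
    using Phi_pos[of q] assms by (simp add: ennreal_minus)
  finally show ?thesis .
qed

lemma stationary_mu: "stationary \<mu>"
  unfolding stationary_iff
proof (intro conjI allI impI)
  show "radon_on_pos \<mu>"
    unfolding radon_on_pos_def
  proof (intro conjI allI impI)
    fix K :: "real set" assume K: "compact K \<and> K \<subseteq> {0<..}"
    then obtain b where b: "\<And>x. x \<in> K \<Longrightarrow> x \<le> b"
      using compact_imp_bounded[of K] bounded_real[of K] by (metis abs_le_D1)
    have "K \<in> sets \<mu>"
      using K borel_compact[of K] by (auto simp: sets_mu sets_restrict_space_iff)
    then have "emeasure \<mu> K = (\<integral>\<^sup>+x. indicator K x \<partial>\<mu>)" by simp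
    also have "\<dots> \<le> (\<integral>\<^sup>+x. ennreal (exp b) * ennreal (exp (- 1 * x)) \<partial>\<mu>)"
      using b by (intro nn_integral_mono) (auto simp flip: ennreal_mult'' exp_add ennreal_1 intro!: ennreal_leI split: split_indicator)
    also have "\<dots> = ennreal (exp b) * (\<integral>\<^sup>+x. ennreal (exp (- 1 * x)) \<partial>\<mu>)"
      by (intro nn_integral_cmult borel_measurable_on_pos[OF sets_mu]) measurable
    also have "\<dots> = ennreal (exp b) * ennreal (Phi 1)"
      by (subst mu_laplace) simp_all
    also have "\<dots> < \<infinity>" by (simp add: ennreal_mult_less_top)
    finally show "emeasure \<mu> K < \<infinity>" .
  qed (rule sets_mu)
  fix t :: real assume t: "0 < t"
  then have t0: "0 \<le> t" by simp
  have gap: "(\<integral>\<^sup>+x. ennreal (exp_gap p q x) \<partial>evolve t \<mu>) = (\<integral>\<^sup>+x. ennreal (exp_gap p q x) \<partial>\<mu>)"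
    if "0 < p" "p < q" for p q
    using that t0 u_strict_mono[of p q t] u_pos[of p t]
    by (simp add: evolve_exp_gap[OF t0 sets_mu] mu_exp_gap Phi_u)
  show "evolve t \<mu> = \<mu>"
  proof (rule measure_on_pos_eq_of_exp_gap_eq[OF sets_evolve[OF t0 sets_mu] sets_mu])
    show "(\<integral>\<^sup>+x. ennreal (exp_gap 1 2 x) \<partial>evolve t \<mu>) < \<infinity>"
      by (simp add: gap mu_exp_gap)
  qed (rule gap, auto)
qed

lemma stationary_unique:
  assumes \<nu>: "stationary \<nu>"
  shows "\<exists>c\<ge>0. \<nu> = scale_measure (ennreal c) \<mu>"
proof -
  obtain c where c: "0 \<le> c" and gap: "\<And>p q. 0 < p \<Longrightarrow> p \<le> q \<Longrightarrow>
      (\<integral>\<^sup>+x. ennreal (exp_gap p q x) \<partial>\<nu>) = ennreal (c * (Phi p - Phi q))"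
    using stationary_exp_gap[OF \<nu>] by blast
  have "\<nu> = scale_measure (ennreal c) \<mu>"
  proof (rule measure_on_pos_eq_of_exp_gap_eq)
    show "sets \<nu> = sets (restrict_space borel {0<..})"
      using \<nu> by (simp add: stationary_def radon_on_pos_def)
    show "sets (scale_measure (ennreal c) \<mu>) = sets (restrict_space borel {0<..})"
      by (simp add: sets_mu)
    fix k :: nat assume k: "1 \<le> k"
    have "(\<integral>\<^sup>+x. ennreal (exp_gap (real k) (real (Suc k)) x) \<partial>scale_measure (ennreal c) \<mu>) =
        ennreal c * (\<integral>\<^sup>+x. ennreal (exp_gap (real k) (real (Suc k)) x) \<partial>\<mu>)"
      by (intro nn_integral_scale_measure borel_measurable_on_pos[OF sets_mu]) measurable
    then show "(\<integral>\<^sup>+x. ennreal (exp_gap (real k) (real (Suc k)) x) \<partial>\<nu>) =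
        (\<integral>\<^sup>+x. ennreal (exp_gap (real k) (real (Suc k)) x) \<partial>scale_measure (ennreal c) \<mu>)"
      using k c by (simp add: gap mu_exp_gap ennreal_mult' del: of_nat_Suc)
  qed (simp add: gap)
  with c show ?thesis by blast
qed

end

theorem theorem2p1:
  fixes \<alpha> \<sigma> :: real and \<pi> :: "real measure"
    and M :: "'w measure" and F :: "ennreal \<Rightarrow> 'w measure"
    and P :: "real \<Rightarrow> 'w measure" and Z :: "real \<Rightarrow> 'w \<Rightarrow> real"
    and u :: "real \<Rightarrow> real \<Rightarrow> real" and W :: "real \<Rightarrow> real"
  assumes "branching_mechanism \<alpha> \<sigma> \<pi>"
    and "cb_process M F P Z (branching_psi \<alpha> \<sigma> \<pi>) u"
    and "scale_function (branching_psi \<alpha> \<sigma> \<pi>) W"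
  shows "let \<mu> = density (restrict_space lborel {0<..}) (\<lambda>x. ennreal (W x / x)) in
           stationary_measure P Z \<mu> \<and>
           (\<forall>\<nu>. stationary_measure P Z \<nu> \<longrightarrow> (\<exists>c::real. 0 \<le> c \<and> \<nu> = scale_measure (ennreal c) \<mu>))"
proof -
  interpret cb_process M F P Z "branching_psi \<alpha> \<sigma> \<pi>" u by fact
  have Z_meas: "Z t \<in> borel_measurable (P x)" if "0 \<le> t" "0 \<le> x" for t x
  proof -
    have "sets (F (ennreal t)) \<subseteq> sets (P x)" "space (F (ennreal t)) = space (P x)"
      using sets_F_subset sets_P[OF that(2)] space_F sets_eq_imp_space_eq[OF sets_P[OF that(2)]] by auto
    then show ?thesis using adapted[OF that(1)] by (auto simp: measurable_def)
  qed
  define D where "D t x = distr (P x) borel (Z t)" for t x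
  interpret branching_kernel "branching_psi \<alpha> \<sigma> \<pi>" W u D
  proof
    show "branching_psi \<alpha> \<sigma> \<pi> 0 = 0" by (simp add: branching_psi_def)
    show "scale_function (branching_psi \<alpha> \<sigma> \<pi>) W" by fact
    show "\<exists>a>0. set_integrable lborel {a..} (\<lambda>q. 1 / branching_psi \<alpha> \<sigma> \<pi> q)"
      using assms(1) by (simp add: branching_mechanism_def)
    show "cumulant_flow (branching_psi \<alpha> \<sigma> \<pi>) u" by (rule flow)
    show "D t \<in> restrict_space borel {0..} \<rightarrow>\<^sub>M prob_algebra borel" if "0 \<le> t" for t
      unfolding D_def using transition_kernel[OF that] .
    show "AE z in D t x. 0 \<le> z" if "0 \<le> t" "0 \<le> x" for t x
      unfolding D_def using Z_nonneg[OF that(1)] sets_eq_imp_space_eq[OF sets_P[OF that(2)]]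
      by (subst AE_distr_iff[OF Z_meas[OF that]]) auto
    show "(LINT z|D t x. exp (- q * z)) = exp (- x * u t q)" if "0 \<le> t" "0 \<le> x" "0 < q" for t x q
      unfolding D_def using laplace[OF that(2,1,3)] by (subst integral_distr[OF Z_meas[OF that(1,2)]]) auto
  qed
  have stationary_measure_iff: "stationary_measure P Z \<nu> \<longleftrightarrow> stationary \<nu>" for \<nu>
  proof (cases "radon_on_pos \<nu>")
    case True
    then have sets: "sets \<nu> = sets (restrict_space borel {0<..})" by (simp add: radon_on_pos_def)
    have "(\<integral>\<^sup>+x. emeasure (P x) {\<omega> \<in> space (P x). Z t \<omega> \<in> A} \<partial>\<nu>) = (\<integral>\<^sup>+x. emeasure (D t x) A \<partial>\<nu>)"
      if "0 < t" "A \<in> sets borel" for t A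
      using that
      by (intro nn_integral_cong)
         (auto simp: D_def emeasure_distr[OF Z_meas] space_on_pos[OF sets] vimage_def Int_def conj_commute)
    then show ?thesis using True by (simp add: stationary_measure_def stationary_def)
  qed (simp add: stationary_measure_def stationary_def)
  show ?thesis
    unfolding Let_def stationary_measure_iff \<mu>_def[symmetric]
    using stationary_mu stationary_unique by auto
qed

end
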